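(* Let $A\subset C$ and $B\subset D$ be inclusions of $C^*$-algebras with $\overline{AC}=C$ and $\overline{BD}=D$ which are strongly Morita equivalent with respect to a $C$-$D$-equivalence bimodule $Y$ and its closed subspace $X$. Then the map $f_{(X,Y)}:{}_B\mathbf{B}_B(D,B)\to{}_A\mathbf{B}_A(C,A)$ is an isometric (linear) isomorphism of ${}_B\mathbf{B}_B(D,B)$ onto ${}_A\mathbf{B}_A(C,A)$.
   Context: For an inclusion $A\subset C$, ${}_A\mathbf{B}_A(C,A)$ is the space (with operator norm) of bounded linear maps $\psi:C\to A$ with $\psi(ac)=a\psi(c)$ and $\psi(ca)=\psi(c)a$ for $a\in A$, $c\in C$; similarly ${}_B\mathbf{B}_B(D,B)$. $\overline{AC}$ denotes the closed linear span of products. Strong Morita equivalence of inclusions: $A\subset C$ and $B\subset D$ are strongly Morita equivalent with respect to a $C$-$D$-equivalence (imprimitivity) bimodule $Y$ (left $C$-valued inner product ${}_C\langle\cdot,\cdot\rangle$, right $D$-valued inner product $\langle\cdot,\cdot\rangle_D$) and its closed subspace $X$ if (i) $a\cdot x\in X$, $x\cdot b\in X$, ${}_C\langle x,z\rangle\in A$, $\langle x,z\rangle_D\in B$ for all $a\in A$, $b\in B$, $x,z\in X$; (ii) the closed linear spans of ${}_C\langle X,X\rangle$, $\langle X,X\rangle_D$, ${}_C\langle Y,X\rangle$, $\langle Y,X\rangle_D$ are $A$, $B$, $C$, $D$ respectively. Then $X$ is an $A$-$B$-equivalence bimodule with the restricted actions and inner products, written ${}_A\langle\cdot,\cdot\rangle$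 and $\langle\cdot,\cdot\rangle_B$. The map $f_{(X,Y)}$: for $\phi\in{}_B\mathbf{B}_B(D,B)$ there is a unique linear map $\tau:Y\to X$ (it is bounded) with $\langle x,\tau(y)\rangle_B=\phi(\langle x,y\rangle_D)$ for all $x\in X$, $y\in Y$, and a unique linear map $\psi:C\to A$ with $\psi(c)\cdot x=\tau(c\cdot x)$ for all $c\in C$, $x\in X$; this $\psi$ lies in ${}_A\mathbf{B}_A(C,A)$. Set $f_{(X,Y)}(\phi)=\psi$. *)

theory Defs
  imports "HOL-Analysis.Analysis"
begin

class scaleC =
  fixes scaleC :: "complex \<Rightarrow> 'a \<Rightarrow> 'a"  (infixr "*\<^sub>C" 75)

class complex_vector = scaleC + ab_group_add +
  assumes scaleC_add_right: "k *\<^sub>C (x + y) = k *\<^sub>C x + k *\<^sub>C y"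
    and scaleC_add_left: "(k + l) *\<^sub>C x = k *\<^sub>C x + l *\<^sub>C x"
    and scaleC_scaleC: "k *\<^sub>C (l *\<^sub>C x) = (k * l) *\<^sub>C x"
    and scaleC_one: "1 *\<^sub>C x = x"

class complex_normed_vector = complex_vector + real_normed_vector +
  assumes scaleR_scaleC: "r *\<^sub>R x = complex_of_real r *\<^sub>C x"
    and norm_scaleC: "norm (k *\<^sub>C x) = cmod k * norm x"

class complex_banach = complex_normed_vector + complete_space

interpretation complex_vector:
  vector_space "scaleC :: complex \<Rightarrow> 'a \<Rightarrow> 'a::complex_vector"
  by unfold_locales (simp_all add: scaleC_add_right scaleC_add_left scaleC_scaleC scaleC_one)

abbreviation csubspace :: "'a::complex_vector set \<Rightarrow> bool"
  where "csubspace \<equiv> complex_vector.subspace"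

abbreviation cspan :: "'a::complex_vector set \<Rightarrow> 'a set"
  where "cspan \<equiv> complex_vector.span"

abbreviation clinear :: "('a::complex_vector \<Rightarrow> 'b::complex_vector) \<Rightarrow> bool"
  where "clinear \<equiv> Vector_Spaces.linear scaleC scaleC"

abbreviation closed_cspan :: "'a::complex_normed_vector set \<Rightarrow> 'a set"
  where "closed_cspan S \<equiv> closure (cspan S)"

text \<open>C*-algebras are not assumed to have a unit.\<close>

class cstar_algebra = complex_banach + real_normed_algebra +
  fixes star :: "'a \<Rightarrow> 'a"
  assumes mult_scaleC_left: "(k *\<^sub>C x) * y = k *\<^sub>C (x * y)"
    and mult_scaleC_right: "x * (k *\<^sub>C y) = k *\<^sub>C (x * y)"
    and star_add: "star (x + y) = star x + star y"
    and star_scaleC: "star (k *\<^sub>C x) = cnj k *\<^sub>C star x"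
    and star_mult: "star (x * y) = star y * star x"
    and star_star: "star (star x) = x"
    and cstar_identity: "norm (star x * x) = (norm x)\<^sup>2"

definition cstar_positive :: "'a::cstar_algebra \<Rightarrow> bool"
  where "cstar_positive a \<longleftrightarrow> (\<exists>b. a = star b * b)"

definition cstar_subalgebra :: "'a::cstar_algebra set \<Rightarrow> bool"
  where "cstar_subalgebra A \<longleftrightarrow>
    csubspace A \<and> closed A \<and> (\<forall>a\<in>A. \<forall>b\<in>A. a * b \<in> A) \<and> (\<forall>a\<in>A. star a \<in> A)"

text \<open>
  The norm of the Banach space \<open>'y\<close> is the Hilbert module norm, so completeness is part
  of the type class. For an equivalence bimodule the norms coming from the two inner products
  coincide, so both refer to this one norm. Left inner products are linear
  in the first variable, right inner products in the second.
\<close>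

locale left_hilbert_module =
  fixes lact :: "'c::cstar_algebra \<Rightarrow> 'y::complex_banach \<Rightarrow> 'y"
    and lin :: "'y \<Rightarrow> 'y \<Rightarrow> 'c"
  assumes lact_add_left: "lact (c + c') y = lact c y + lact c' y"
    and lact_add_right: "lact c (y + y') = lact c y + lact c y'"
    and lact_scaleC_left: "lact (k *\<^sub>C c) y = k *\<^sub>C lact c y"
    and lact_scaleC_right: "lact c (k *\<^sub>C y) = k *\<^sub>C lact c y"
    and lact_mult: "lact (c * c') y = lact c (lact c' y)"
    and lin_add_left: "lin (y + y') z = lin y z + lin y' z"
    and lin_scaleC_left: "lin (k *\<^sub>C y) z = k *\<^sub>C lin y z"
    and lin_lact_left: "lin (lact c y) z = c * lin y z"
    and star_lin: "star (lin y z) = lin z y"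
    and lin_positive: "cstar_positive (lin y y)"
    and norm_lin: "norm y = sqrt (norm (lin y y))"

locale right_hilbert_module =
  fixes ract :: "'y::complex_banach \<Rightarrow> 'd::cstar_algebra \<Rightarrow> 'y"
    and rin :: "'y \<Rightarrow> 'y \<Rightarrow> 'd"
  assumes ract_add_left: "ract (y + y') d = ract y d + ract y' d"
    and ract_add_right: "ract y (d + d') = ract y d + ract y d'"
    and ract_scaleC_left: "ract (k *\<^sub>C y) d = k *\<^sub>C ract y d"
    and ract_scaleC_right: "ract y (k *\<^sub>C d) = k *\<^sub>C ract y d"
    and ract_mult: "ract y (d * d') = ract (ract y d) d'"
    and rin_add_right: "rin y (z + z') = rin y z + rin y z'"
    and rin_scaleC_right: "rin y (k *\<^sub>C z) = k *\<^sub>C rin y z"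
    and rin_ract_right: "rin y (ract z d) = rin y z * d"
    and star_rin: "star (rin y z) = rin z y"
    and rin_positive: "cstar_positive (rin y y)"
    and norm_rin: "norm y = sqrt (norm (rin y y))"

locale equivalence_bimodule =
  left_hilbert_module lact lin + right_hilbert_module ract rin
  for lact :: "'c::cstar_algebra \<Rightarrow> 'y::complex_banach \<Rightarrow> 'y"
    and ract :: "'y \<Rightarrow> 'd::cstar_algebra \<Rightarrow> 'y"
    and lin :: "'y \<Rightarrow> 'y \<Rightarrow> 'c"
    and rin :: "'y \<Rightarrow> 'y \<Rightarrow> 'd" +
  assumes lact_ract: "ract (lact c y) d = lact c (ract y d)"
    and lin_ract: "lin (ract y d) z = lin y (ract z (star d))"
    and rin_lact: "rin (lact c y) z = rin y (lact (star c) z)"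
    and lin_rin: "lact (lin x y) z = ract x (rin y z)"
    and lin_full: "closed_cspan {lin y z | y z. True} = UNIV"
    and rin_full: "closed_cspan {rin y z | y z. True} = UNIV"

definition inclusion_morita_equivalence ::
  "'c::cstar_algebra set \<Rightarrow> 'd::cstar_algebra set \<Rightarrow> 'y::complex_banach set \<Rightarrow>
    ('c \<Rightarrow> 'y \<Rightarrow> 'y) \<Rightarrow> ('y \<Rightarrow> 'd \<Rightarrow> 'y) \<Rightarrow> ('y \<Rightarrow> 'y \<Rightarrow> 'c) \<Rightarrow> ('y \<Rightarrow> 'y \<Rightarrow> 'd) \<Rightarrow> bool"
  where "inclusion_morita_equivalence A B X lact ract lin rin \<longleftrightarrow>
    equivalence_bimodule lact ract lin rin \<and>
    csubspace X \<and> closed X \<and>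
    (\<forall>a\<in>A. \<forall>x\<in>X. lact a x \<in> X) \<and>
    (\<forall>x\<in>X. \<forall>b\<in>B. ract x b \<in> X) \<and>
    (\<forall>x\<in>X. \<forall>z\<in>X. lin x z \<in> A) \<and>
    (\<forall>x\<in>X. \<forall>z\<in>X. rin x z \<in> B) \<and>
    closed_cspan {lin x z | x z. x \<in> X \<and> z \<in> X} = A \<and>
    closed_cspan {rin x z | x z. x \<in> X \<and> z \<in> X} = B \<and>
    closed_cspan {lin y x | y x. x \<in> X} = UNIV \<and>
    closed_cspan {rin y x | y x. x \<in> X} = UNIV"

text \<open>
  A map from the ambient C*-algebra to the subalgebra \<open>A\<close> is represented as a map into
  the ambient algebra with range in \<open>A\<close>; its operator norm is \<^const>\<open>onorm\<close>.
\<close>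

definition bounded_bimodule_maps :: "'c::cstar_algebra set \<Rightarrow> ('c \<Rightarrow> 'c) set"
  where "bounded_bimodule_maps A =
    {\<psi>. clinear \<psi> \<and> bounded_linear \<psi> \<and> range \<psi> \<subseteq> A \<and>
      (\<forall>a\<in>A. \<forall>c. \<psi> (a * c) = a * \<psi> c \<and> \<psi> (c * a) = \<psi> c * a)}"

text \<open>
  The descriptions below are satisfied by exactly one function when \<open>\<phi>\<close> is a bounded
  bimodule map and the inclusions are strongly Morita equivalent.
\<close>

definition tau_map ::
  "'y::complex_vector set \<Rightarrow> ('y \<Rightarrow> 'y \<Rightarrow> 'd) \<Rightarrow> ('d \<Rightarrow> 'd) \<Rightarrow> 'y \<Rightarrow> 'y"
  where "tau_map X rin \<phi> =
    (THE \<tau>. clinear \<tau> \<and> range \<tau> \<subseteq> X \<and> (\<forall>x\<in>X. \<forall>y. rin x (\<tau> y) = \<phi> (rin x y)))"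

definition morita_map ::
  "'c::complex_vector set \<Rightarrow> 'y::complex_vector set \<Rightarrow> ('c \<Rightarrow> 'y \<Rightarrow> 'y) \<Rightarrow>
    ('y \<Rightarrow> 'y \<Rightarrow> 'd) \<Rightarrow> ('d \<Rightarrow> 'd) \<Rightarrow> 'c \<Rightarrow> 'c"
  where "morita_map A X lact rin \<phi> =
    (THE \<psi>. clinear \<psi> \<and> range \<psi> \<subseteq> A \<and>
      (\<forall>c. \<forall>x\<in>X. lact (\<psi> c) x = tau_map X rin \<phi> (lact c x)))"

end

theory Submission
  imports Defs
begin

text \<open>
  The idea. For a bimodule map \<open>\<phi>\<close> the map \<open>\<tau>\<close> must send \<open>ract x d\<close> to \<open>ract x (\<phi> d)\<close> when \<open>x \<in> X\<close>,
  and these elements span a dense subspace of \<open>Y\<close>, so \<open>\<tau>\<close> exists as soon as it is bounded there; the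
  bound \<open>norm (\<tau> y) \<le> onorm \<phi> * norm y\<close> comes from
  \<open>(norm (\<tau> y))\<^sup>2 = norm (\<phi> (rin (\<tau> y) y))\<close> and Cauchy--Schwarz. Likewise \<open>\<psi>\<close> must send \<open>lin y x\<close> to
  \<open>lin (\<tau> y) x\<close>, and it is bounded with the same constant because \<open>A\<close> acts isometrically on \<open>X\<close>.
  So both maps are unique continuous extensions, and \<open>onorm \<psi> \<le> onorm \<phi>\<close>.

  The four equations \<open>rin x (\<tau> y) = \<phi> (rin x y)\<close>, \<open>\<tau> (ract x d) = ract x (\<phi> d)\<close>,
  \<open>lin (\<tau> y) x = \<psi> (lin y x)\<close>, \<open>\<tau> (lact c x) = lact (\<psi> c) x\<close> are symmetric in the left and the
  right side of the bimodule. Exchanging the sides, which means passing to the conjugate bimodule,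
  therefore turns the construction into its own inverse: each \<open>\<psi>\<close> arises from a \<open>\<phi>\<close> with
  \<open>onorm \<phi> \<le> onorm \<psi>\<close>. Bijectivity and isometry follow at once, and linearity is inherited from
  the equations (\<open>linked_exists\<close>, \<open>linked_exists_dual\<close>, \<open>linked_unique\<close>, \<open>linked_unique_dual\<close>).

  Three analytic facts carry the argument, each proved without functional calculus:
  Cauchy--Schwarz (\<open>norm_rin_le\<close>), density of \<open>lact C Y\<close> in \<open>Y\<close> (\<open>lact_dense\<close>), and the isometric
  action of \<open>A\<close> on \<open>X\<close> (\<open>norm_le_lact\<close>).
\<close>

section \<open>Preliminaries\<close>

lemma norm_star: "norm (star a) = norm (a::'a::cstar_algebra)"
proof -
  have le: "norm b \<le> norm (star b)" for b :: 'a
  proof (cases "b = 0")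
    case False
    have "norm b * norm b \<le> norm (star b) * norm b"
      using norm_mult_ineq[of "star b" b] by (simp add: cstar_identity power2_eq_square)
    with False show ?thesis by simp
  qed simp
  show ?thesis using le[of a] le[of "star a"] by (simp add: star_star)
qed

lemma bounded_linear_star: "bounded_linear (star :: 'a \<Rightarrow> 'a::cstar_algebra)"
  by (rule bounded_linear_intro[where K = 1])
    (simp_all add: star_add scaleR_scaleC star_scaleC norm_star)

lemma norm_square_selfadjoint:
  "star a = a \<Longrightarrow> norm (a * a) = (norm (a::'a::cstar_algebra))\<^sup>2"
  using cstar_identity[of a] by simp

lemma bounded_linear_scaleC: "bounded_linear (\<lambda>x. k *\<^sub>C (x::'a::complex_normed_vector))"
  by (rule bounded_linear_intro[where K = "cmod k"])
    (simp_all add: scaleC_add_right scaleR_scaleC scaleC_scaleC norm_scaleC mult.commute)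

lemma cspan_eq_span:
  fixes S :: "'a::complex_normed_vector set"
  assumes "\<And>k s. s \<in> S \<Longrightarrow> k *\<^sub>C s \<in> S"
  shows "cspan S = span S"
proof
  have "k *\<^sub>C x \<in> span S" if "x \<in> span S" for k x
    using that
  proof (induction rule: span_induct_alt)
    case (step c s y)
    have "k *\<^sub>C (c *\<^sub>R s + y) = c *\<^sub>R (k *\<^sub>C s) + k *\<^sub>C y"
      by (simp add: scaleC_add_right scaleR_scaleC scaleC_scaleC mult.commute)
    then show ?case
      using step assms[of s k] by (auto intro: span_add span_mul span_base)
  qed (simp add: complex_vector.scale_zero_right span_zero)
  then show "cspan S \<subseteq> span S"
    by (intro complex_vector.span_minimal complex_vector.subspaceI)
      (auto intro: span_base span_add span_zero)
  have "subspace (cspan S)"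
    by (auto simp: subspace_def scaleR_scaleC complex_vector.span_zero
        intro: complex_vector.span_add complex_vector.span_scale)
  then show "span S \<subseteq> cspan S"
    by (intro span_minimal complex_vector.span_superset)
qed

lemma closed_subspace_UNIV:
  assumes "closed T" "subspace T" "S \<subseteq> T" "closure (span S) = UNIV"
  shows "T = UNIV"
proof -
  have "closure (span S) \<subseteq> T"
    using assms by (intro closure_minimal span_minimal)
  with assms show ?thesis by auto
qed

lemma subspace_closure_real:
  assumes "subspace (S :: 'a::real_normed_vector set)"
  shows "subspace (closure S)"
proof (rule subspaceI)
  show "0 \<in> closure S"
    using subspace_0[OF assms] closure_subset by blast
next
  fix x y assume "x \<in> closure S" "y \<in> closure S"
  then obtain u v where "\<forall>n. u n \<in> S" "u \<longlonglongrightarrow> x" "\<forall>n. v n \<in> S" "v \<longlonglongrightarrow> y"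
    by (auto simp: closure_sequential)
  then show "x + y \<in> closure S"
    unfolding closure_sequential
    by (intro exI[of _ "\<lambda>n. u n + v n"]) (auto intro: tendsto_add subspace_add[OF assms])
next
  fix c x assume "x \<in> closure S"
  then obtain u where "\<forall>n. u n \<in> S" "u \<longlonglongrightarrow> x"
    by (auto simp: closure_sequential)
  then show "c *\<^sub>R x \<in> closure S"
    unfolding closure_sequential
    by (intro exI[of _ "\<lambda>n. c *\<^sub>R u n"]) (auto intro: tendsto_intros subspace_scale[OF assms])
qed

lemma closed_subspace_vimage:
  assumes "bounded_linear f" "closed T" "subspace T"
  shows "closed {x. f x \<in> T}" "subspace {x. f x \<in> T}"
proof -
  interpret bounded_linear f by fact
  show "closed {x. f x \<in> T}"
    using \<open>closed T\<close> continuous_closed_vimage[of T f] isCont[OF continuous_ident]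
    by (simp add: vimage_def)
  show "subspace {x. f x \<in> T}"
    using \<open>subspace T\<close> by (auto simp: subspace_def zero add scaleR)
qed

text \<open>
  A closed linear relation with an a priori bound is single valued, and its domain is closed
  because the bound turns a Cauchy sequence of arguments into a Cauchy sequence of values.
  Both \<open>\<tau>\<close> and \<open>\<psi>\<close> are obtained this way, from the relations given by the equations that define
  them.
\<close>

lemma closed_relation_is_map:
  fixes G :: "('a::real_normed_vector \<times> 'b::{real_normed_vector,complete_space}) set"
  assumes "closed G" "subspace G"
    and bound: "\<And>y z. (y, z) \<in> G \<Longrightarrow> norm z \<le> K * norm y"
    and dense: "closure (span S) = UNIV" and S: "S \<subseteq> fst ` G"
  shows "\<exists>f. bounded_linear f \<and> (\<forall>y. norm (f y) \<le> K * norm y) \<and>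
    (\<forall>y z. (y, z) \<in> G \<longleftrightarrow> z = f y)"
proof -
  have diff: "(y - y', z - z') \<in> G" if "(y, z) \<in> G" "(y', z') \<in> G" for y z y' z'
    using subspace_diff[OF \<open>subspace G\<close> that] by simp
  have add: "(y + y', z + z') \<in> G" if "(y, z) \<in> G" "(y', z') \<in> G" for y z y' z'
    using subspace_add[OF \<open>subspace G\<close> that] by simp
  have scale: "(r *\<^sub>R y, r *\<^sub>R z) \<in> G" if "(y, z) \<in> G" for y z r
    using subspace_scale[OF \<open>subspace G\<close> that] by simp
  have "closed (fst ` G)"
    unfolding closed_sequential_limits
  proof (intro allI impI, elim conjE)
    fix u y assume u: "\<forall>n. u n \<in> fst ` G" and lim: "u \<longlonglongrightarrow> y"
    have "\<exists>v. (u n, v) \<in> G" for n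
      using u[rule_format, of n] by auto
    then obtain v where v: "\<And>n. (u n, v n) \<in> G" by metis
    have "norm (v m - v n) \<le> K * norm (u m - u n)" for m n
      using bound[OF diff[OF v v]] .
    then have vle: "norm (v m - v n) \<le> (\<bar>K\<bar> + 1) * norm (u m - u n)" for m n
      by (rule order_trans) (auto intro!: mult_right_mono)
    have "Cauchy v"
    proof (rule metric_CauchyI)
      fix e :: real assume "e > 0"
      then have "e / (\<bar>K\<bar> + 1) > 0"
        by (intro divide_pos_pos) auto
      then obtain M where M: "dist (u m) (u n) < e / (\<bar>K\<bar> + 1)" if "m \<ge> M" "n \<ge> M" for m n
        using metric_CauchyD[OF LIMSEQ_imp_Cauchy[OF lim]] by blast
      have "dist (v m) (v n) < e" if "m \<ge> M" "n \<ge> M" for m n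
      proof -
        have "norm (u m - u n) * (\<bar>K\<bar> + 1) < e"
          using M[OF that] by (subst (asm) pos_less_divide_eq) (auto simp: dist_norm)
        then show ?thesis
          using vle[of m n] by (simp add: dist_norm mult.commute)
      qed
      then show "\<exists>M. \<forall>m\<ge>M. \<forall>n\<ge>M. dist (v m) (v n) < e" by blast
    qed
    then obtain z where "v \<longlonglongrightarrow> z"
      using Cauchy_convergent convergentD by blast
    then have "(\<lambda>n. (u n, v n)) \<longlonglongrightarrow> (y, z)"
      using lim by (intro tendsto_Pair)
    then have "(y, z) \<in> G"
      using \<open>closed G\<close> v closed_sequentially[of G "\<lambda>n. (u n, v n)"] by blast
    then show "y \<in> fst ` G" by force
  qed
  moreover have "subspace (fst ` G)"
    by (intro linear_subspace_image linear_fst \<open>subspace G\<close>)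
  ultimately have total: "fst ` G = UNIV"
    using closed_subspace_UNIV S dense by blast
  have "\<exists>z. (y, z) \<in> G" for y
    using total[THEN eqset_imp_iff, of y] by auto
  then obtain f where f: "\<And>y. (y, f y) \<in> G" by metis
  have iff: "(y, z) \<in> G \<longleftrightarrow> z = f y" for y z
  proof
    assume "(y, z) \<in> G"
    then have "norm (z - f y) \<le> K * norm (y - y)"
      using bound diff f by blast
    then show "z = f y" by simp
  qed (simp add: f)
  have le: "norm (f y) \<le> K * norm y" for y
    using bound f by blast
  have "bounded_linear f"
  proof (rule bounded_linear_intro[where K = K])
    show "f (x + y) = f x + f y" for x y
      using add[OF f f] iff by metis
    show "f (r *\<^sub>R x) = r *\<^sub>R f x" for r x
      using scale[OF f] iff by metis
    show "norm (f x) \<le> norm x * K" for x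
      using le[of x] by (simp add: mult.commute)
  qed
  then show ?thesis using le iff by blast
qed

section \<open>Norm estimates and nondegeneracy of an equivalence bimodule\<close>

lemma (in left_hilbert_module) norm_lin_self: "norm (lin y y) = (norm y)\<^sup>2"
  using norm_lin[of y] by (metis norm_ge_zero real_sqrt_pow2)

lemma (in right_hilbert_module) norm_rin_self: "norm (rin y y) = (norm y)\<^sup>2"
  using norm_rin[of y] by (metis norm_ge_zero real_sqrt_pow2)

lemma (in left_hilbert_module) lin_add_right: "lin y (z + z') = lin y z + lin y z'"
  by (metis lin_add_left star_add star_lin)

lemma (in left_hilbert_module) lin_scaleC_right: "lin y (k *\<^sub>C z) = cnj k *\<^sub>C lin y z"
  by (metis lin_scaleC_left star_lin star_scaleC)

lemma (in left_hilbert_module) lin_lact_right: "lin y (lact c z) = lin y z * star c"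
  by (metis lin_lact_left star_lin star_mult star_star)

lemma (in right_hilbert_module) rin_add_left: "rin (y + y') z = rin y z + rin y' z"
  by (metis rin_add_right star_add star_rin)

lemma (in right_hilbert_module) rin_scaleC_left: "rin (k *\<^sub>C y) z = cnj k *\<^sub>C rin y z"
  by (metis rin_scaleC_right star_rin star_scaleC)

lemma (in right_hilbert_module) rin_ract_left: "rin (ract y d) z = star d * rin y z"
  by (metis rin_ract_right star_rin star_mult)

text \<open>
  Each action is estimated with the inner product on its own side, where it comes out as a factor:
  \<open>lin (lact c y) (lact c y) = c * lin y y * star c\<close>. Since both inner products define the same
  norm, the two estimates can then be combined.
\<close>

lemma (in left_hilbert_module) norm_lact_le: "norm (lact c y) \<le> norm c * norm y"
proof -
  have "(norm (lact c y))\<^sup>2 = norm (c * (lin y y * star c))"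
    by (simp add: norm_lin_self[symmetric] lin_lact_left lin_lact_right mult.assoc)
  also have "\<dots> \<le> norm c * (norm (lin y y) * norm (star c))"
    by (intro order_trans[OF norm_mult_ineq] mult_left_mono norm_mult_ineq norm_ge_zero)
  also have "\<dots> = (norm c * norm y)\<^sup>2"
    by (simp add: norm_star norm_lin_self power2_eq_square)
  finally show ?thesis
    by (rule power2_le_imp_le) simp
qed

lemma (in right_hilbert_module) norm_ract_le: "norm (ract y d) \<le> norm y * norm d"
proof -
  have "(norm (ract y d))\<^sup>2 = norm (star d * (rin y y * d))"
    by (simp add: norm_rin_self[symmetric] rin_ract_left rin_ract_right mult.assoc)
  also have "\<dots> \<le> norm (star d) * (norm (rin y y) * norm d)"
    by (intro order_trans[OF norm_mult_ineq] mult_left_mono norm_mult_ineq norm_ge_zero)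
  also have "\<dots> = (norm y * norm d)\<^sup>2"
    by (simp add: norm_star norm_rin_self power2_eq_square)
  finally show ?thesis
    by (rule power2_le_imp_le) simp
qed

context equivalence_bimodule
begin

text \<open>
  Cauchy--Schwarz without the order of the algebra: \<open>rin y x * rin x y = rin y (lact (lin x x) y)\<close>,
  and writing \<open>lin x x = star b * b\<close> turns the right-hand side into \<open>rin (lact b y) (lact b y)\<close>,
  whose norm is controlled by the left-hand norm estimate.
\<close>

lemma norm_rin_le: "norm (rin x y) \<le> norm x * norm y"
proof -
  obtain b where b: "lin x x = star b * b"
    using lin_positive[of x] by (auto simp: cstar_positive_def)
  have nb: "(norm b)\<^sup>2 = (norm x)\<^sup>2"
    using cstar_identity[of b] norm_lin_self[of x] b by simp
  have "star (rin x y) * rin x y = rin y (ract x (rin x y))"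
    by (simp add: star_rin rin_ract_right)
  also have "\<dots> = rin y (lact (star b) (lact b y))"
    by (simp add: lin_rin[symmetric] b lact_mult)
  also have "\<dots> = rin (lact b y) (lact b y)"
    by (simp add: rin_lact)
  finally have "(norm (rin x y))\<^sup>2 = (norm (lact b y))\<^sup>2"
    by (metis cstar_identity norm_rin_self)
  also have "\<dots> \<le> (norm b * norm y)\<^sup>2"
    by (intro power_mono norm_lact_le) simp
  also have "\<dots> = (norm x * norm y)\<^sup>2"
    by (simp add: power_mult_distrib nb)
  finally show ?thesis by (rule power2_le_imp_le) simp
qed

lemma norm_lin_le: "norm (lin x y) \<le> norm x * norm y"
proof -
  obtain b where b: "rin y y = star b * b"
    using rin_positive[of y] by (auto simp: cstar_positive_def)
  have nb: "(norm b)\<^sup>2 = (norm y)\<^sup>2"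
    using cstar_identity[of b] norm_rin_self[of y] b by simp
  have "lin x y * star (lin x y) = lin (lact (lin x y) y) x"
    by (simp add: star_lin lin_lact_left)
  also have "\<dots> = lin (ract (ract x (star b)) b) x"
    by (simp add: lin_rin b ract_mult)
  also have "\<dots> = lin (ract x (star b)) (ract x (star b))"
    by (simp add: lin_ract)
  finally have "(norm (lin x y))\<^sup>2 = (norm (ract x (star b)))\<^sup>2"
    by (metis cstar_identity norm_lin_self norm_star star_star)
  also have "\<dots> \<le> (norm x * norm (star b))\<^sup>2"
    by (intro power_mono norm_ract_le) simp
  also have "\<dots> = (norm x * norm y)\<^sup>2"
    by (simp add: power_mult_distrib nb norm_star)
  finally show ?thesis by (rule power2_le_imp_le) simp
qed

lemma bounded_bilinear_lact: "bounded_bilinear lact"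
  by (intro bounded_bilinear.intro exI[of _ 1])
    (simp_all add: lact_add_left lact_add_right scaleR_scaleC lact_scaleC_left lact_scaleC_right
      norm_lact_le)

lemma bounded_bilinear_ract: "bounded_bilinear ract"
  by (intro bounded_bilinear.intro exI[of _ 1])
    (simp_all add: ract_add_left ract_add_right scaleR_scaleC ract_scaleC_left ract_scaleC_right
      norm_ract_le)

lemma bounded_bilinear_lin: "bounded_bilinear lin"
  by (intro bounded_bilinear.intro exI[of _ 1])
    (simp_all add: lin_add_left lin_add_right scaleR_scaleC lin_scaleC_left lin_scaleC_right
      norm_lin_le)

lemma bounded_bilinear_rin: "bounded_bilinear rin"
  by (intro bounded_bilinear.intro exI[of _ 1])
    (simp_all add: rin_add_left rin_add_right scaleR_scaleC rin_scaleC_left rin_scaleC_right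
      norm_rin_le)

end

text \<open>
  An operator with a lower bound \<open>m\<close> stays surjective under perturbations with Lipschitz constant
  below \<open>m\<close>: solving \<open>T y = z - P y\<close> for the \<open>y\<close> on the left is a contraction. The lemma serves
  to invert \<open>lact h + i t\<close> for all \<open>t\<close> in a sequence tending to \<open>0\<close>.
\<close>

lemma surj_perturb:
  fixes T P :: "'a::{real_normed_vector,complete_space} \<Rightarrow> 'a"
  assumes "surj T" and T: "\<And>y y'. m * norm (y - y') \<le> norm (T y - T y')"
    and P: "\<And>y y'. norm (P y - P y') \<le> q * norm (y - y')"
    and q: "0 \<le> q" "q < m"
  shows "surj (\<lambda>y. T y + P y)"
proof -
  have "\<exists>y. z = T y + P y" for z
  proof -
    define F where "F y = inv T (z - P y)" for y
    have TF: "T (F y) = z - P y" for y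
      by (simp add: F_def surj_f_inv_f \<open>surj T\<close>)
    have "dist (F y) (F y') \<le> (q / m) * dist y y'" for y y'
    proof -
      have "m * norm (F y - F y') \<le> norm (P y' - P y)"
        using T[of "F y" "F y'"] by (simp add: TF)
      also have "\<dots> \<le> q * norm (y - y')"
        using P[of y y'] by (simp add: norm_minus_commute)
      finally show ?thesis
        using q by (simp add: dist_norm field_simps)
    qed
    then have "\<exists>!y. F y = y"
      using q by (intro banach_fix_type[of "q / m"]) auto
    then obtain y where "F y = y" by blast
    then have "z = T y + P y" using TF[of y] by simp
    then show ?thesis ..
  qed
  then show ?thesis by (simp add: surj_def)
qed

context equivalence_bimodule
begin

interpretation lact: bounded_bilinear lact by (rule bounded_bilinear_lact)
interpretation ract: bounded_bilinear ract by (rule bounded_bilinear_ract)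
interpretation lin: bounded_bilinear lin by (rule bounded_bilinear_lin)
interpretation rin: bounded_bilinear rin by (rule bounded_bilinear_rin)

definition shift :: "'c \<Rightarrow> real \<Rightarrow> 'y \<Rightarrow> 'y"
  where "shift h t y = lact h y + (\<i> * complex_of_real t) *\<^sub>C y"

lemma shift_diff: "shift h t (y - y') = shift h t y - shift h t y'"
  by (simp add: shift_def lact.diff_right complex_vector.scale_right_diff_distrib)

lemma shift_ract: "shift h t (ract y d) = ract (shift h t y) d"
  by (simp add: shift_def lact_ract ract_add_left ract_scaleC_left)

lemma shift_scaleC: "shift h t (k *\<^sub>C y) = k *\<^sub>C shift h t y"
  by (simp add: shift_def lact_scaleC_right scaleC_add_right scaleC_scaleC mult.commute)

lemma rin_shift:
  assumes "star h = h"
  shows "rin (shift h t y) z = rin y (shift h (- t) z)"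
  using assms by (simp add: shift_def rin_add_left rin_add_right rin_scaleC_left rin_scaleC_right
      rin_lact rin.diff_right)

lemma shift_shift: "shift h s (shift h t y) = shift h t (shift h s y)"
  by (simp add: shift_def lact_add_right lact_scaleC_right scaleC_add_right scaleC_scaleC
      mult.commute ac_simps)

text \<open>
  For self-adjoint \<open>h\<close> the operator \<open>lact h + i t\<close> and its adjoint \<open>lact h - i t\<close> commute, so they
  have the same Gram elements and the same norm at every \<open>y\<close>. Half the difference and half the
  sum of the two are \<open>i t\<close> and \<open>lact h\<close>, which the triangle inequality therefore bounds by either of
  them.
\<close>

lemma norm_shift_uminus:
  assumes "star h = h"
  shows "norm (shift h (- t) y) = norm (shift h t y)"
proof -
  have "rin (shift h (- t) y) (shift h (- t) y) = rin (shift h t y) (shift h t y)"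
    by (simp add: rin_shift[OF assms] shift_shift[of h "- t" t])
  then show ?thesis by (simp add: norm_rin)
qed

lemma norm_shift_ge:
  assumes "star h = h"
  shows "\<bar>t\<bar> * norm y \<le> norm (shift h t y)" and "norm (lact h y) \<le> norm (shift h t y)"
proof -
  have "shift h t y - shift h (- t) y = (2 * \<i> * complex_of_real t) *\<^sub>C y"
    by (simp add: shift_def scaleC_add_left[symmetric] complex_vector.scale_minus_left)
  then have "2 * (\<bar>t\<bar> * norm y) = norm (shift h t y - shift h (- t) y)"
    by (simp add: norm_scaleC norm_mult)
  also have "\<dots> \<le> norm (shift h t y) + norm (shift h (- t) y)"
    by (rule norm_triangle_ineq4)
  finally show "\<bar>t\<bar> * norm y \<le> norm (shift h t y)"
    by (simp add: norm_shift_uminus[OF assms])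
  have "shift h t y + shift h (- t) y = 2 *\<^sub>R lact h y"
    by (simp add: shift_def complex_vector.scale_minus_left scaleR_2)
  then have "2 * norm (lact h y) = norm (shift h t y + shift h (- t) y)"
    by simp
  also have "\<dots> \<le> norm (shift h t y) + norm (shift h (- t) y)"
    by (rule norm_triangle_ineq)
  finally show "norm (lact h y) \<le> norm (shift h t y)"
    by (simp add: norm_shift_uminus[OF assms])
qed

lemma surj_shift_large:
  assumes "norm h < \<bar>t\<bar>"
  shows "surj (shift h t)"
proof -
  let ?k = "\<i> * complex_of_real t"
  have "t \<noteq> 0" using assms by (cases "t = 0") auto
  have "surj ((*\<^sub>C) ?k :: 'y \<Rightarrow> 'y)"
  proof (rule surjI)
    show "?k *\<^sub>C (inverse ?k *\<^sub>C y) = y" for y :: 'y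
      using \<open>t \<noteq> 0\<close> by (subst scaleC_scaleC, subst right_inverse) (auto simp: scaleC_one)
  qed
  then have "surj (\<lambda>y. ?k *\<^sub>C y + lact h y)"
  proof (rule surj_perturb)
    show "\<bar>t\<bar> * norm (y - y') \<le> norm (?k *\<^sub>C y - ?k *\<^sub>C y')" for y y' :: 'y
      by (simp add: complex_vector.scale_right_diff_distrib[symmetric] norm_scaleC norm_mult)
    show "norm (lact h y - lact h y') \<le> norm h * norm (y - y')" for y y'
      using norm_lact_le[of h "y - y'"] by (simp add: lact.diff_right)
  qed (use assms in auto)
  then show ?thesis by (simp add: shift_def[abs_def] add.commute)
qed

text \<open>
  The lower bound of \<open>lact h + i t\<close> is \<open>t\<close> itself, so the parameter can be halved in one step.
\<close>

lemma surj_shift_half: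
  assumes "star h = h" "t \<noteq> 0" "surj (shift h t)"
  shows "surj (shift h (t / 2))"
proof -
  let ?k = "- \<i> * complex_of_real (t / 2)"
  have "surj (\<lambda>y. shift h t y + ?k *\<^sub>C y)"
  proof (rule surj_perturb[OF assms(3)])
    show "\<bar>t\<bar> * norm (y - y') \<le> norm (shift h t y - shift h t y')" for y y'
      using norm_shift_ge(1)[OF assms(1), of t "y - y'"] by (simp add: shift_diff)
    show "norm (?k *\<^sub>C y - ?k *\<^sub>C y') \<le> \<bar>t / 2\<bar> * norm (y - y')" for y y' :: 'y
      unfolding complex_vector.scale_right_diff_distrib[symmetric] norm_scaleC
      by (simp add: norm_mult norm_divide)
  qed (use assms in auto)
  moreover have "shift h t y + ?k *\<^sub>C y = shift h (t / 2) y" for y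
    unfolding shift_def add.assoc scaleC_add_left[symmetric]
    by (simp add: field_simps)
  ultimately show ?thesis by simp
qed

lemma surj_shift_power:
  assumes "star h = h" "norm h < \<bar>t\<bar>"
  shows "surj (shift h (t / 2 ^ n))"
proof (induction n)
  case 0
  then show ?case using surj_shift_large assms by simp
next
  case (Suc n)
  have "t \<noteq> 0" using assms by (cases "t = 0") auto
  then show ?case
    using surj_shift_half[OF assms(1) _ Suc] by (simp add: mult.commute)
qed

text \<open>
  The element \<open>z\<close> is approximated by \<open>lact h v\<close> where \<open>h = lin z z\<close> and \<open>v\<close> solves
  \<open>(h + i t) v = z\<close>. The error \<open>e = i t v\<close> satisfies \<open>(h + i t) e = i t z\<close>, so the operator
  \<open>k = lact (lin e e)\<close> satisfies \<open>(h + i t) k (h - i t) = t\<^sup>2 h\<close>. As \<open>h + i t\<close> has lower bound \<open>t\<close>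
  and \<open>h - i t\<close> dominates \<open>h\<close>, the operator \<open>k\<close> has norm at most \<open>t\<close>; applied to \<open>e\<close> this
  bounds \<open>(norm e)\<^sup>2\<close>.
\<close>

lemma lact_approximates:
  assumes "t > 0" and surj: "surj (shift (lin z z) t)" "surj (shift (lin z z) (- t))"
  obtains v where "(norm (z - lact (lin z z) v))\<^sup>2 \<le> t"
proof -
  let ?h = "lin z z"
  have h: "star ?h = ?h" by (simp add: star_lin)
  let ?it = "\<i> * complex_of_real t"
  obtain v where v: "shift ?h t v = z" using surj(1) by (metis surjD)
  define e where "e = ?it *\<^sub>C v"
  have e: "z - lact ?h v = e"
    using v by (auto simp: e_def shift_def algebra_simps)
  have se: "shift ?h t e = ?it *\<^sub>C z"
    by (simp add: e_def shift_scaleC v)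
  obtain y where y: "shift ?h (- t) y = e" using surj(2) by (metis surjD)
  have "shift ?h t (ract e (rin e e)) = ract (shift ?h t e) (rin (shift ?h t e) y)"
    by (simp add: shift_ract rin_shift[OF h] y)
  also have "\<dots> = (?it * cnj ?it) *\<^sub>C lact ?h y"
    by (simp add: se ract_scaleC_left ract_scaleC_right rin_scaleC_left scaleC_scaleC lin_rin
        ract.minus_right complex_vector.scale_minus_right)
  finally have "norm (shift ?h t (ract e (rin e e))) = t\<^sup>2 * norm (lact ?h y)"
    by (simp add: norm_scaleC norm_mult power2_eq_square)
  also have "\<dots> \<le> t\<^sup>2 * norm e"
    using norm_shift_ge(2)[OF h, of y "- t"] y by (intro mult_left_mono) auto
  finally have "norm (shift ?h t (ract e (rin e e))) \<le> t * (t * norm e)"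
    by (simp add: power2_eq_square mult.assoc)
  moreover have "t * norm (ract e (rin e e)) \<le> norm (shift ?h t (ract e (rin e e)))"
    using norm_shift_ge(1)[OF h, of t "ract e (rin e e)"] \<open>t > 0\<close> by simp
  ultimately have "t * norm (ract e (rin e e)) \<le> t * (t * norm e)"
    by (rule order_trans[rotated])
  with \<open>t > 0\<close> have k: "norm (ract e (rin e e)) \<le> t * norm e" by simp
  have "(norm e)\<^sup>2 * (norm e)\<^sup>2 = norm (rin e (ract e (rin e e)))"
    using norm_square_selfadjoint[of "rin e e"]
    by (simp add: rin_ract_right star_rin norm_rin_self power2_eq_square)
  also have "\<dots> \<le> norm e * (t * norm e)"
    using norm_rin_le k by (rule order_trans[OF _ mult_left_mono]) simp
  finally have "(norm e)\<^sup>2 * (norm e)\<^sup>2 \<le> (norm e)\<^sup>2 * t"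
    by (simp add: power2_eq_square ac_simps)
  then have "(norm e)\<^sup>2 \<le> t"
    by (cases "e = 0") (use \<open>t > 0\<close> mult_le_cancel_left_pos[of "(norm e)\<^sup>2" "(norm e)\<^sup>2" t] in auto)
  with e that show thesis by blast
qed

lemma lact_dense: "closure (span {lact c y | c y. True}) = UNIV"
proof -
  have "z \<in> closure {lact c y | c y. True}" for z
    unfolding closure_approachable
  proof (intro allI impI)
    fix \<epsilon> :: real assume "\<epsilon> > 0"
    let ?h = "lin z z" and ?t = "norm (lin z z) + 1"
    have "(\<lambda>n. ?t / 2 ^ n) \<longlonglongrightarrow> 0"
      by (rule LIMSEQ_divide_realpow_zero) simp
    then have "\<forall>\<^sub>F n in sequentially. ?t / 2 ^ n < \<epsilon>\<^sup>2"
      by (rule order_tendstoD) (use \<open>\<epsilon> > 0\<close> in simp)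
    then obtain n where n: "?t / 2 ^ n < \<epsilon>\<^sup>2"
      by (auto simp: eventually_sequentially)
    have h: "star ?h = ?h" by (simp add: star_lin)
    have pos: "?t / 2 ^ n > 0"
      by (intro divide_pos_pos add_nonneg_pos) auto
    have s1: "surj (shift ?h (?t / 2 ^ n))"
      by (rule surj_shift_power[OF h]) simp
    have s2: "surj (shift ?h (- ?t / 2 ^ n))"
      by (rule surj_shift_power[OF h]) simp
    obtain v where "(norm (z - lact ?h v))\<^sup>2 \<le> ?t / 2 ^ n"
      using lact_approximates[OF pos s1] s2 by (auto simp: minus_divide_left)
    with n have "(norm (z - lact ?h v))\<^sup>2 < \<epsilon>\<^sup>2" by linarith
    then have "norm (z - lact ?h v) < \<epsilon>"
      by (rule power2_less_imp_less) (use \<open>\<epsilon> > 0\<close> in simp)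
    then show "\<exists>y\<in>{lact c y | c y. True}. dist y z < \<epsilon>"
      unfolding dist_norm norm_minus_commute[of _ z] by blast
  qed
  moreover have "closure {lact c y | c y. True} \<subseteq> closure (span {lact c y | c y. True})"
    by (intro closure_mono span_superset)
  ultimately show ?thesis by blast
qed

lemma lin_full_real: "closure (span {lin y z | y z. True}) = UNIV"
proof -
  have "cspan {lin y z | y z. True} = span {lin y z | y z. True}"
    by (rule cspan_eq_span) (blast intro: lin_scaleC_left[symmetric])
  with lin_full show ?thesis by simp
qed

text \<open>
  Density of \<open>ract Y D\<close> follows from density of \<open>lact C Y\<close>: by fullness \<open>C\<close> is densely spanned by
  the \<open>lin y z\<close>, and \<open>lact (lin y z) w = ract y (rin z w)\<close>.
\<close>

lemma ract_dense: "closure (span {ract y d | y d. True}) = UNIV"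
proof -
  let ?T = "closure (span {ract y d | y d. True})"
  have T: "closed ?T" "subspace ?T"
    by (auto intro: subspace_closure_real)
  have "{c. lact c w \<in> ?T} = UNIV" for w
  proof (rule closed_subspace_UNIV[OF _ _ _ lin_full_real])
    show "closed {c. lact c w \<in> ?T}" "subspace {c. lact c w \<in> ?T}"
      using closed_subspace_vimage[OF lact.bounded_linear_left T] by auto
    show "{lin y z | y z. True} \<subseteq> {c. lact c w \<in> ?T}"
    proof clarify
      fix y z
      have "ract y (rin z w) \<in> {ract y d | y d. True}" by blast
      then show "lact (lin y z) w \<in> ?T"
        unfolding lin_rin by (rule subsetD[OF closure_subset span_base])
    qed
  qed
  then have "lact c w \<in> ?T" for c w by blast
  then have "{lact c y | c y. True} \<subseteq> ?T" by (intro subsetI) (elim CollectE exE, simp)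
  then show ?thesis
    using closed_subspace_UNIV[OF T _ lact_dense] by blast
qed

end

section \<open>Inclusions of bimodules, with real scalars\<close>

text \<open>
  The structure of an inclusion of equivalence bimodules without its complex scalars, in a form
  that is symmetric in the two sides. Density of the two actions is among the axioms because
  its proof for equivalence bimodules uses the imaginary unit.
\<close>

locale bimodule_inclusion =
  fixes A :: "'c::cstar_algebra set" and B :: "'d::cstar_algebra set"
    and X :: "'y::{real_normed_vector,complete_space} set"
    and lact :: "'c \<Rightarrow> 'y \<Rightarrow> 'y" and ract :: "'y \<Rightarrow> 'd \<Rightarrow> 'y"
    and lin :: "'y \<Rightarrow> 'y \<Rightarrow> 'c" and rin :: "'y \<Rightarrow> 'y \<Rightarrow> 'd"
  assumes bilinear_lact: "bounded_bilinear lact" and bilinear_ract: "bounded_bilinear ract"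
    and bilinear_lin: "bounded_bilinear lin" and bilinear_rin: "bounded_bilinear rin"
    and norm_lact: "norm (lact c y) \<le> norm c * norm y"
    and norm_ract: "norm (ract y d) \<le> norm y * norm d"
    and norm_lin: "norm (lin y z) \<le> norm y * norm z"
    and norm_rin: "norm (rin y z) \<le> norm y * norm z"
    and norm_lin_self: "norm (lin y y) = (norm y)\<^sup>2"
    and norm_rin_self: "norm (rin y y) = (norm y)\<^sup>2"
    and lact_mult: "lact (c * c') y = lact c (lact c' y)"
    and ract_mult: "ract y (d * d') = ract (ract y d) d'"
    and lact_ract: "ract (lact c y) d = lact c (ract y d)"
    and star_lin: "star (lin y z) = lin z y"
    and star_rin: "star (rin y z) = rin z y"
    and lin_lact: "lin (lact c y) z = c * lin y z"
    and rin_ract: "rin y (ract z d) = rin y z * d"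
    and lin_ract: "lin (ract y d) z = lin y (ract z (star d))"
    and rin_lact: "rin (lact c y) z = rin y (lact (star c) z)"
    and lin_rin: "lact (lin x y) z = ract x (rin y z)"
    and subspaces: "subspace A" "subspace B" "subspace X" "closed A" "closed B" "closed X"
    and mult_A: "a \<in> A \<Longrightarrow> a' \<in> A \<Longrightarrow> a * a' \<in> A" and star_A: "a \<in> A \<Longrightarrow> star a \<in> A"
    and mult_B: "b \<in> B \<Longrightarrow> b' \<in> B \<Longrightarrow> b * b' \<in> B" and star_B: "b \<in> B \<Longrightarrow> star b \<in> B"
    and lact_mem: "a \<in> A \<Longrightarrow> x \<in> X \<Longrightarrow> lact a x \<in> X"
    and ract_mem: "x \<in> X \<Longrightarrow> b \<in> B \<Longrightarrow> ract x b \<in> X"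
    and lin_mem: "x \<in> X \<Longrightarrow> z \<in> X \<Longrightarrow> lin x z \<in> A"
    and rin_mem: "x \<in> X \<Longrightarrow> z \<in> X \<Longrightarrow> rin x z \<in> B"
    and A_generated: "A \<subseteq> closure (span {lin x z | x z. x \<in> X \<and> z \<in> X})"
    and B_generated: "B \<subseteq> closure (span {rin x z | x z. x \<in> X \<and> z \<in> X})"
    and lin_dense: "closure (span {lin y x | y x. x \<in> X}) = UNIV"
    and rin_dense: "closure (span {rin y x | y x. x \<in> X}) = UNIV"
    and lact_dense: "closure (span {lact c y | c y. True}) = UNIV"
    and ract_dense: "closure (span {ract y d | y d. True}) = UNIV"
begin

sublocale lact: bounded_bilinear lact by (rule bilinear_lact)
sublocale ract: bounded_bilinear ract by (rule bilinear_ract)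
sublocale lin: bounded_bilinear lin by (rule bilinear_lin)
sublocale rin: bounded_bilinear rin by (rule bilinear_rin)

text \<open>
  The conjugate bimodule. Its complex structure is the conjugate one, which is the reason for
  working with real scalars: all the data live on the same types, and every statement
  about the pair \<open>(A, B)\<close> holds for \<open>(B, A)\<close> as well.
\<close>

lemma dual:
  "bimodule_inclusion B A X (\<lambda>d y. ract y (star d)) (\<lambda>y c. lact (star c) y) rin lin"
proof (rule bimodule_inclusion.intro)
  have "bounded_bilinear (\<lambda>y d. ract y (star d))"
    using bounded_bilinear.comp[OF bilinear_ract bounded_linear_ident bounded_linear_star] .
  then show "bounded_bilinear (\<lambda>d y. ract y (star d))"
    by (rule bounded_bilinear.flip)
  have "bounded_bilinear (\<lambda>c y. lact (star c) y)"
    using bounded_bilinear.comp[OF bilinear_lact bounded_linear_star bounded_linear_ident] .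
  then show "bounded_bilinear (\<lambda>y c. lact (star c) y)"
    by (rule bounded_bilinear.flip)
  have "{ract y (star d) | d y. True} = {ract y d | y d. True}"
    by (intro equalityI subsetI; clarsimp; metis star_star)
  then show "closure (span {ract y (star d) | d y. True}) = UNIV"
    using ract_dense by simp
  have "{lact (star c) y | y c. True} = {lact c y | c y. True}"
    by (intro equalityI subsetI; clarsimp; metis star_star)
  then show "closure (span {lact (star c) y | y c. True}) = UNIV"
    using lact_dense by simp
  show "lact (star c) (ract y (star d)) = ract (lact (star c) y) (star d)" for c d y
    by (simp add: lact_ract)
  show "norm (ract y (star d)) \<le> norm d * norm y" for y d
    using norm_ract[of y "star d"] by (simp add: norm_star mult.commute)
  show "norm (lact (star c) y) \<le> norm y * norm c" for y c
    using norm_lact[of "star c" y] by (simp add: norm_star mult.commute)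
  show "rin (ract y (star d)) z = d * rin y z" for y z d
    by (metis rin_ract star_mult star_rin star_star)
  show "lin y (lact (star c) z) = lin y z * c" for y z c
    by (metis lin_lact star_mult star_lin star_star)
  show "rin (lact (star c) y) z = rin y (lact (star (star c)) z)" for y z c
    by (simp add: rin_lact)
  show "lin (ract y (star d)) z = lin y (ract z (star (star d)))" for y z d
    by (simp add: lin_ract)
  show "ract z (star (rin x y)) = lact (star (lin y z)) x" for x y z
    by (simp add: star_rin star_lin lin_rin)
qed (simp_all add: bilinear_lin bilinear_rin norm_lin norm_rin norm_lin_self norm_rin_self lact_mult
    ract_mult star_mult star_lin star_rin subspaces mult_A mult_B star_A star_B lact_mem ract_mem
    lin_mem rin_mem A_generated B_generated lin_dense rin_dense)

lemma rin_cancel: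
  assumes "z \<in> X" "z' \<in> X" "\<And>x. x \<in> X \<Longrightarrow> rin x z = rin x z'"
  shows "z = z'"
proof -
  have "rin (z - z') (z - z') = 0"
    using assms subspace_diff[OF subspaces(3)] by (simp add: rin.diff_right)
  then show ?thesis using norm_rin_self[of "z - z'"] by simp
qed

text \<open>
  The point is that one constant \<open>K\<close>, depending on \<open>s\<close>, serves for all \<open>b\<close>; it comes from
  \<open>b * lin x z = lin (lact b x) z\<close>.
\<close>

lemma norm_mult_span_le:
  assumes "s \<in> span {lin x z | x z. x \<in> X \<and> z \<in> X}"
  shows "\<exists>K\<ge>0. \<forall>b N. (\<forall>x\<in>X. norm (lact b x) \<le> N * norm x) \<longrightarrow> norm (b * s) \<le> K * N"
  using assms
proof (induction rule: span_induct_alt)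
  case base
  then show ?case by auto
next
  case (step c u s)
  then obtain K where K: "K \<ge> 0"
    "\<And>b N. \<forall>x\<in>X. norm (lact b x) \<le> N * norm x \<Longrightarrow> norm (b * s) \<le> K * N" by auto
  obtain x z where xz: "u = lin x z" "x \<in> X" using step by auto
  have "norm (b * (c *\<^sub>R u + s)) \<le> (\<bar>c\<bar> * (norm x * norm z) + K) * N"
    if b: "\<forall>x\<in>X. norm (lact b x) \<le> N * norm x" for b N
  proof -
    have "norm (b * u) \<le> norm (lact b x) * norm z"
      using norm_lin[of "lact b x" z] by (simp add: xz lin_lact)
    also have "\<dots> \<le> (N * norm x) * norm z"
      using b xz by (intro mult_right_mono) auto
    finally have "\<bar>c\<bar> * norm (b * u) \<le> \<bar>c\<bar> * (N * norm x * norm z)"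
      by (intro mult_left_mono) auto
    moreover have "norm (b * (c *\<^sub>R u + s)) \<le> \<bar>c\<bar> * norm (b * u) + norm (b * s)"
      using norm_triangle_ineq[of "c *\<^sub>R (b * u)" "b * s"] by (simp add: distrib_left)
    ultimately show ?thesis
      using K(2)[OF b] by (simp add: algebra_simps)
  qed
  with K(1) show ?case
    by (intro exI[of _ "\<bar>c\<bar> * (norm x * norm z) + K"]) auto
qed

text \<open>
  A spectral radius argument. Let \<open>s\<close> be an element of the span of \<open>lin X X\<close> close to \<open>h\<close>. Then
  \<open>norm (h ^ n * s)\<close> is at most a constant times \<open>M ^ n\<close>, by the preceding lemma, while it is
  at least half of \<open>norm h ^ (n + 1)\<close> whenever \<open>n + 1\<close> is a power of two, by the C*-identity.
\<close>

lemma norm_le_lact_selfadjoint: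
  assumes "h \<in> A" and h: "star h = h" and M: "0 \<le> M" "\<And>x. x \<in> X \<Longrightarrow> norm (lact h x) \<le> M * norm x"
  shows "norm h \<le> M"
proof (rule ccontr)
  assume "\<not> norm h \<le> M"
  then have less: "M < norm h" and pos: "0 < norm h" using M(1) by auto
  \<comment> \<open>The algebra need not have a unit, so \<open>p n\<close> stands for the power with exponent \<open>n + 1\<close>.\<close>
  define p where "p n = ((*) h ^^ n) h" for n
  have p0: "p 0 = h" and pSuc: "p (Suc n) = h * p n" for n
    by (simp_all add: p_def)
  have p_add: "p m * p n = p (Suc (m + n))" for m n
    by (induction m) (simp_all add: p0 pSuc mult.assoc)
  have p_star: "star (p n) = p n" for n
  proof (induction n)
    case (Suc n)
    have "star (p (Suc n)) = p n * h" by (simp add: pSuc star_mult Suc h)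
    also have "\<dots> = p (Suc n)" using p_add[of n 0] by (simp add: p0)
    finally show ?case .
  qed (simp add: p0 h)
  have p_le: "norm (p n) \<le> norm h ^ Suc n" for n
  proof (induction n)
    case (Suc n)
    have "norm (p (Suc n)) \<le> norm h * norm (p n)"
      by (simp add: pSuc norm_mult_ineq)
    also have "\<dots> \<le> norm h * norm h ^ Suc n"
      using Suc by (intro mult_left_mono) auto
    finally show ?case by simp
  qed (simp add: p0)
  have p_dbl: "norm (p (2 ^ k - 1)) = norm h ^ (2 ^ k)" for k
  proof (induction k)
    case (Suc k)
    have "Suc ((2 ^ k - 1) + (2 ^ k - 1)) = (2 ^ Suc k - 1 :: nat)"
      using one_le_power[of "2::nat" k] unfolding power_Suc by linarith
    then have "norm (p (2 ^ Suc k - 1)) = norm (p (2 ^ k - 1) * p (2 ^ k - 1))"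
      by (simp only: p_add)
    also have "\<dots> = (norm h ^ (2 ^ k))\<^sup>2"
      by (simp only: norm_square_selfadjoint[OF p_star] Suc)
    finally show ?case by (simp add: power_mult[symmetric] mult.commute)
  qed (simp add: p0)
  have p_act: "lact (p n) x \<in> X \<and> norm (lact (p n) x) \<le> M ^ Suc n * norm x" if "x \<in> X" for n x
  proof (induction n)
    case 0
    then show ?case using that M(2) lact_mem[OF \<open>h \<in> A\<close>] by (simp add: p0)
  next
    case (Suc n)
    have "norm (lact (p (Suc n)) x) \<le> M * norm (lact (p n) x)"
      using Suc M(2) by (simp add: pSuc lact_mult)
    also have "\<dots> \<le> M * (M ^ Suc n * norm x)"
      using Suc M(1) by (intro mult_left_mono) auto
    finally show ?case
      using Suc lact_mem[OF \<open>h \<in> A\<close>] by (simp add: pSuc lact_mult mult.assoc)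
  qed
  obtain s where s: "s \<in> span {lin x z | x z. x \<in> X \<and> z \<in> X}" "norm (h - s) \<le> norm h / 2"
  proof -
    have "h \<in> closure (span {lin x z | x z. x \<in> X \<and> z \<in> X})"
      using A_generated \<open>h \<in> A\<close> by blast
    then obtain s where "s \<in> span {lin x z | x z. x \<in> X \<and> z \<in> X}" "dist s h < norm h / 2"
      using pos unfolding closure_approachable by (meson half_gt_zero)
    then show thesis using that by (simp add: dist_norm norm_minus_commute)
  qed
  obtain K where K: "K \<ge> 0"
    "\<And>b N. \<forall>x\<in>X. norm (lact b x) \<le> N * norm x \<Longrightarrow> norm (b * s) \<le> K * N"
    using norm_mult_span_le[OF s(1)] by blast
  have growth: "norm (p (Suc n)) \<le> K * M ^ Suc n + norm h ^ Suc (Suc n) / 2" for n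
  proof -
    have "p (Suc n) = p n * s + p n * (h - s)"
      using p_add[of n 0] by (simp add: p0 right_diff_distrib)
    then have "norm (p (Suc n)) \<le> norm (p n * s) + norm (p n * (h - s))"
      by (metis norm_triangle_ineq)
    moreover have "norm (p n * s) \<le> K * M ^ Suc n"
      using p_act by (intro K(2)) auto
    moreover have "norm (p n * (h - s)) \<le> norm h ^ Suc n * (norm h / 2)"
      using p_le[of n] s(2)
      by (intro order_trans[OF norm_mult_ineq] mult_mono) auto
    ultimately show ?thesis by (simp add: mult.commute)
  qed
  have bound: "norm h \<le> 2 * K * (M / norm h) ^ (2 ^ Suc k - 1)" for k
  proof -
    have "2 \<le> (2::nat) ^ Suc k" by simp
    then have "2 ^ Suc k = Suc (Suc (2 ^ Suc k - 2))" by linarith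
    then obtain n where n: "2 ^ Suc k = Suc (Suc n)" ..
    have "norm h ^ Suc (Suc n) \<le> K * M ^ Suc n + norm h ^ Suc (Suc n) / 2"
      using growth[of n] p_dbl[of "Suc k"] n by simp
    then have "norm h * norm h ^ Suc n \<le> 2 * K * M ^ Suc n"
      unfolding power_Suc[of "norm h" "Suc n"] by linarith
    then have "norm h \<le> 2 * K * M ^ Suc n / norm h ^ Suc n"
      by (subst pos_le_divide_eq[OF zero_less_power[OF pos]])
    moreover have "2 ^ Suc k - 1 = Suc n" using n by linarith
    ultimately show ?thesis by (simp only: power_divide times_divide_eq_right)
  qed
  have "(\<lambda>n. 2 * K * (M / norm h) ^ n) \<longlonglongrightarrow> 2 * K * 0"
    using M(1) less pos by (intro tendsto_mult_left LIMSEQ_realpow_zero) auto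
  then have "\<forall>\<^sub>F n in sequentially. 2 * K * (M / norm h) ^ n < norm h"
    using pos by (intro order_tendstoD) auto
  then obtain n0 where n0: "\<And>n. n \<ge> n0 \<Longrightarrow> 2 * K * (M / norm h) ^ n < norm h"
    by (auto simp: eventually_sequentially)
  have "n0 < 2 ^ Suc n0"
    by (meson less_exp less_trans lessI)
  then have "n0 \<le> 2 ^ Suc n0 - 1" by simp
  from n0[OF this] bound[of n0] show False by simp
qed

text \<open>
  Faithful actions of C*-algebras are isometric. The self-adjoint case applies to \<open>star a * a\<close>,
  since the bound on the action of \<open>a\<close> passes to its adjoint.
\<close>

lemma norm_le_lact:
  assumes a: "a \<in> A" and M: "0 \<le> M" "\<And>x. x \<in> X \<Longrightarrow> norm (lact a x) \<le> M * norm x"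
  shows "norm a \<le> M"
proof -
  have "norm (star a * a) \<le> M\<^sup>2"
  proof (rule norm_le_lact_selfadjoint)
    show "norm (lact (star a * a) x) \<le> M\<^sup>2 * norm x" if x: "x \<in> X" for x
    proof -
      have *: "norm (lact (star a) y) \<le> M * norm y" if y: "y \<in> X" for y
      proof -
        let ?w = "lact (star a) y"
        have w: "?w \<in> X" using star_A a y lact_mem by blast
        have "norm ?w * norm ?w = norm (rin y (lact a ?w))"
          using norm_rin_self[of ?w] by (simp add: rin_lact star_star power2_eq_square)
        also have "\<dots> \<le> norm y * (M * norm ?w)"
          using M(2)[OF w] by (intro order_trans[OF norm_rin] mult_left_mono) auto
        finally have "norm ?w * norm ?w \<le> (M * norm y) * norm ?w"
          by (simp add: ac_simps)
        then show ?thesis using M(1) by (cases "?w = 0") auto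
      qed
      have "norm (lact (star a * a) x) \<le> M * norm (lact a x)"
        using *[OF lact_mem[OF a x]] by (simp add: lact_mult)
      also have "\<dots> \<le> M * (M * norm x)"
        using M x by (intro mult_left_mono) auto
      finally show ?thesis by (simp add: power2_eq_square mult.assoc)
    qed
  qed (use a in \<open>auto intro: mult_A star_A simp: star_mult star_star\<close>)
  then show ?thesis
    by (intro power2_le_imp_le[OF _ M(1)]) (simp add: cstar_identity)
qed

lemma lact_cancel:
  assumes "a \<in> A" "a' \<in> A" "\<And>x. x \<in> X \<Longrightarrow> lact a x = lact a' x"
  shows "a = a'"
proof -
  have "norm (a - a') \<le> 0"
    using assms subspace_diff[OF subspaces(1)] by (intro norm_le_lact) (auto simp: lact.diff_left)
  then show ?thesis by simp
qed

text \<open>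
  \<open>ract X D\<close> spans a dense subspace of \<open>Y\<close>: it contains \<open>lact (lin x y) z = ract x (rin y z)\<close>,
  and the elements \<open>lin x y\<close> densely span \<open>C\<close> since their adjoints do.
\<close>

lemma ract_X_dense: "closure (span {ract x d | x d. x \<in> X}) = UNIV"
proof -
  let ?T = "closure (span {ract x d | x d. x \<in> X})"
  have T: "closed ?T" "subspace ?T"
    by (auto intro: subspace_closure_real)
  have "{c. lact (star c) z \<in> ?T} = UNIV" for z
  proof (rule closed_subspace_UNIV[OF _ _ _ lin_dense])
    have "bounded_linear (\<lambda>c. lact (star c) z)"
      by (rule bounded_linear_compose[OF lact.bounded_linear_left bounded_linear_star])
    from closed_subspace_vimage[OF this T]
    show "closed {c. lact (star c) z \<in> ?T}" "subspace {c. lact (star c) z \<in> ?T}" .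
    show "{lin y x | y x. x \<in> X} \<subseteq> {c. lact (star c) z \<in> ?T}"
    proof clarify
      fix y x assume "x \<in> X"
      then have "ract x (rin y z) \<in> {ract x d | x d. x \<in> X}" by blast
      then show "lact (star (lin y x)) z \<in> ?T"
        unfolding star_lin lin_rin by (rule subsetD[OF closure_subset span_base])
    qed
  qed
  then have "star c \<in> {c. lact (star c) z \<in> ?T}" for c z by blast
  then have "lact c z \<in> ?T" for c z unfolding mem_Collect_eq star_star .
  then have "{lact c y | c y. True} \<subseteq> ?T" by (intro subsetI) (elim CollectE exE, simp)
  then show ?thesis
    using closed_subspace_UNIV[OF T _ lact_dense] by blast
qed

end

section \<open>The correspondence\<close>

text \<open>
  Only real linearity is asked for, so that the notion is stable under conjugation; complex linearity
  follows later. Carrying a bound \<open>K\<close> of the operator norm makes the isometry part of the existence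
  statements.
\<close>

definition bimodule_map_bound :: "'a::cstar_algebra set \<Rightarrow> real \<Rightarrow> ('a \<Rightarrow> 'a) \<Rightarrow> bool"
  where "bimodule_map_bound A K \<psi> \<longleftrightarrow>
    bounded_linear \<psi> \<and> range \<psi> \<subseteq> A \<and>
    (\<forall>a\<in>A. \<forall>c. \<psi> (a * c) = a * \<psi> c \<and> \<psi> (c * a) = \<psi> c * a) \<and>
    0 \<le> K \<and> (\<forall>c. norm (\<psi> c) \<le> K * norm c)"

text \<open>
  Passing to the conjugate bimodule inserts adjoints into the actions; this is the corresponding
  operation on bimodule maps.
\<close>

definition star_conj :: "('a::cstar_algebra \<Rightarrow> 'a) \<Rightarrow> 'a \<Rightarrow> 'a"
  where "star_conj \<psi> c = star (\<psi> (star c))"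

lemma star_conj_star_conj: "star_conj (star_conj \<psi>) = \<psi>"
  by (rule ext) (simp add: star_conj_def star_star)

lemma bimodule_map_bound_star_conj:
  assumes "bimodule_map_bound A K \<psi>" and star: "\<And>a. a \<in> A \<Longrightarrow> star a \<in> A"
  shows "bimodule_map_bound A K (star_conj \<psi>)"
proof -
  have "bounded_linear (\<lambda>c. star (\<psi> (star c)))"
    using bounded_linear_compose[OF bounded_linear_star
        bounded_linear_compose[OF _ bounded_linear_star]] assms(1)
    unfolding bimodule_map_bound_def by blast
  moreover have "star (\<psi> (star (a * c))) = a * star (\<psi> (star c))"
    "star (\<psi> (star (c * a))) = star (\<psi> (star c)) * a" if "a \<in> A" for a c
    using assms(1) star[OF that] by (simp_all add: bimodule_map_bound_def star_mult star_star)
  moreover have "norm (star (\<psi> (star c))) \<le> K * norm c" for c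
    using assms(1) norm_star[of c] by (metis bimodule_map_bound_def norm_star)
  moreover have "star (\<psi> (star c)) \<in> A" for c
    using assms(1) by (intro star) (auto simp: bimodule_map_bound_def)
  ultimately show ?thesis
    using assms(1) by (auto simp: bimodule_map_bound_def star_conj_def[abs_def])
qed

context bimodule_inclusion
begin

text \<open>
  The pairs \<open>(ract x d, ract x (\<phi> d))\<close> satisfy the defining equation of \<open>\<tau>\<close> because \<open>\<phi>\<close> is left
  \<open>B\<close>-linear, and Cauchy--Schwarz bounds all pairs that satisfy it.
\<close>

lemma tau_exists:
  assumes "bimodule_map_bound B K \<phi>"
  obtains \<tau> where "bounded_linear \<tau>" "\<And>y. norm (\<tau> y) \<le> K * norm y" "\<And>y. \<tau> y \<in> X"
    "\<And>x y. x \<in> X \<Longrightarrow> rin x (\<tau> y) = \<phi> (rin x y)"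
    "\<And>x d. x \<in> X \<Longrightarrow> \<tau> (ract x d) = ract x (\<phi> d)"
proof -
  interpret \<phi>: bounded_linear \<phi>
    using assms by (simp add: bimodule_map_bound_def)
  have \<phi>B: "\<phi> d \<in> B" and \<phi>l: "b \<in> B \<Longrightarrow> \<phi> (b * d) = b * \<phi> d"
    and K: "0 \<le> K" "norm (\<phi> d) \<le> K * norm d" for b d
    using assms by (auto simp: bimodule_map_bound_def)
  define G where "G = {p. snd p \<in> X \<and> (\<forall>x\<in>X. rin x (snd p) = \<phi> (rin x (fst p)))}"
  have "bounded_linear (\<lambda>p. \<phi> (rin x (fst p)))" "bounded_linear (\<lambda>p. rin x (snd p))"
    for x and p :: "'y \<times> 'y"
    by (auto intro!: bounded_linear_compose[OF \<phi>.bounded_linear]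
        bounded_linear_compose[OF rin.bounded_linear_right] bounded_linear_fst bounded_linear_snd)
  then have "closed {p. rin x (snd p) = \<phi> (rin x (fst p))}" for x
    by (intro closed_Collect_eq linear_continuous_on)
  moreover have "closed {p :: 'y \<times> 'y. snd p \<in> X}"
    using closed_vimage_snd[OF subspaces(6)] by (simp add: vimage_def)
  ultimately have G_closed: "closed G"
    unfolding G_def Collect_conj_eq Collect_ball_eq by (intro closed_Int closed_INT ballI)
  have G_subspace: "subspace G"
    using subspaces(3) unfolding G_def subspace_def
    by (auto simp: rin.add_right rin.scaleR_right rin.zero_right \<phi>.zero \<phi>.add \<phi>.scaleR)
  have G_bound: "norm z \<le> K * norm y" if "(y, z) \<in> G" for y z
  proof -
    have "norm z * norm z = norm (\<phi> (rin z y))"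
      using that norm_rin_self[of z] by (simp add: G_def power2_eq_square)
    also have "\<dots> \<le> K * (norm z * norm y)"
      using K norm_rin[of z y] by (intro order_trans[OF K(2)] mult_left_mono) auto
    finally have "norm z * norm z \<le> norm z * (K * norm y)"
      by (simp add: ac_simps)
    then show ?thesis
      using K by (cases "z = 0") auto
  qed
  have graph: "(ract x d, ract x (\<phi> d)) \<in> G" if "x \<in> X" for x d
    using that by (auto simp: G_def ract_mem \<phi>B rin_ract \<phi>l rin_mem)
  then have G_dense: "{ract x d | x d. x \<in> X} \<subseteq> fst ` G"
    by force
  obtain \<tau> where \<tau>: "bounded_linear \<tau>" "\<And>y. norm (\<tau> y) \<le> K * norm y"
    "\<And>y z. (y, z) \<in> G \<longleftrightarrow> z = \<tau> y"
    using closed_relation_is_map[OF G_closed G_subspace G_bound ract_X_dense G_dense] by blast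
  have "(y, \<tau> y) \<in> G" for y using \<tau>(3) by simp
  then have "\<tau> y \<in> X" "x \<in> X \<Longrightarrow> rin x (\<tau> y) = \<phi> (rin x y)" for x y
    by (auto simp: G_def)
  moreover have "x \<in> X \<Longrightarrow> \<tau> (ract x d) = ract x (\<phi> d)" for x d
    using \<tau>(3) graph by simp
  ultimately show thesis using that \<tau>(1,2) by blast
qed

text \<open>
  The defining equations of \<open>\<tau>\<close> and \<open>\<psi>\<close> together with their mirror images. They
  determine \<open>\<psi>\<close> from \<open>\<phi>\<close> and \<open>\<phi>\<close> from \<open>\<psi>\<close>, with the same \<open>\<tau>\<close> in between.
\<close>

definition linked :: "('d \<Rightarrow> 'd) \<Rightarrow> ('y \<Rightarrow> 'y) \<Rightarrow> ('c \<Rightarrow> 'c) \<Rightarrow> bool"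
  where "linked \<phi> \<tau> \<psi> \<longleftrightarrow>
    (\<forall>d. \<phi> d \<in> B) \<and> (\<forall>y. \<tau> y \<in> X) \<and> (\<forall>c. \<psi> c \<in> A) \<and>
    (\<forall>x\<in>X. \<forall>y. rin x (\<tau> y) = \<phi> (rin x y)) \<and>
    (\<forall>x\<in>X. \<forall>y. lin (\<tau> y) x = \<psi> (lin y x)) \<and>
    (\<forall>x\<in>X. \<forall>d. \<tau> (ract x d) = ract x (\<phi> d)) \<and>
    (\<forall>x\<in>X. \<forall>c. \<tau> (lact c x) = lact (\<psi> c) x)"

text \<open>
  The pairs \<open>(lin y x, lin (\<tau> y) x)\<close> satisfy the defining equation of \<open>\<psi>\<close> because \<open>\<tau>\<close> is
  right \<open>B\<close>-linear, and the isometric action of \<open>A\<close> on \<open>X\<close> bounds all pairs that satisfy it.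
\<close>

lemma linked_exists:
  assumes "bimodule_map_bound B K \<phi>"
  obtains \<tau> \<psi> where "linked \<phi> \<tau> \<psi>" "bimodule_map_bound A K \<psi>"
proof -
  obtain \<tau> where "bounded_linear \<tau>" and \<tau>K: "\<And>y. norm (\<tau> y) \<le> K * norm y"
    and \<tau>X: "\<And>y. \<tau> y \<in> X" and rin_\<tau>: "\<And>x y. x \<in> X \<Longrightarrow> rin x (\<tau> y) = \<phi> (rin x y)"
    and \<tau>_ract: "\<And>x d. x \<in> X \<Longrightarrow> \<tau> (ract x d) = ract x (\<phi> d)"
    using tau_exists[OF assms] by blast
  interpret \<tau>: bounded_linear \<tau> by fact
  have \<phi>B: "\<phi> d \<in> B" and \<phi>r: "b \<in> B \<Longrightarrow> \<phi> (d * b) = \<phi> d * b" and K: "0 \<le> K" for b d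
    using assms by (auto simp: bimodule_map_bound_def)
  have \<tau>B: "\<tau> (ract y b) = ract (\<tau> y) b" if "b \<in> B" for y b
    by (rule rin_cancel) (simp_all add: \<tau>X ract_mem that rin_\<tau> rin_ract \<phi>r)
  have \<tau>A: "\<tau> (lact a y) = lact a (\<tau> y)" if "a \<in> A" for a y
  proof (rule rin_cancel)
    have "rin x (lact a z) = rin (lact (star a) x) z" for x z
      by (simp add: rin_lact star_star)
    then show "rin x (\<tau> (lact a y)) = rin x (lact a (\<tau> y))" if "x \<in> X" for x
      using that \<open>a \<in> A\<close> by (simp add: rin_\<tau> lact_mem star_A)
  qed (simp_all add: \<tau>X lact_mem that)
  define G where "G = {p. snd p \<in> A \<and> (\<forall>x\<in>X. lact (snd p) x = \<tau> (lact (fst p) x))}"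
  have "bounded_linear (\<lambda>p. \<tau> (lact (fst p) x))" "bounded_linear (\<lambda>p. lact (snd p) x)"
    for x and p :: "'c \<times> 'c"
    by (auto intro!: bounded_linear_compose[OF \<tau>.bounded_linear]
        bounded_linear_compose[OF lact.bounded_linear_left] bounded_linear_fst bounded_linear_snd)
  then have "closed {p. lact (snd p) x = \<tau> (lact (fst p) x)}" for x
    by (intro closed_Collect_eq linear_continuous_on)
  moreover have "closed {p :: 'c \<times> 'c. snd p \<in> A}"
    using closed_vimage_snd[OF subspaces(4)] by (simp add: vimage_def)
  ultimately have G_closed: "closed G"
    unfolding G_def Collect_conj_eq Collect_ball_eq by (intro closed_Int closed_INT ballI)
  have G_subspace: "subspace G"
    using subspaces(1) unfolding G_def subspace_def
    by (auto simp: lact.add_left lact.scaleR_left lact.zero_left \<tau>.zero \<tau>.add \<tau>.scaleR)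
  have G_bound: "norm a \<le> K * norm c" if "(c, a) \<in> G" for c a
  proof (rule norm_le_lact)
    show "norm (lact a x) \<le> K * norm c * norm x" if "x \<in> X" for x
    proof -
      have "norm (lact a x) = norm (\<tau> (lact c x))"
        using that \<open>(c, a) \<in> G\<close> by (simp add: G_def)
      also have "\<dots> \<le> K * (norm c * norm x)"
        using K norm_lact by (intro order_trans[OF \<tau>K] mult_left_mono)
      finally show ?thesis by (simp add: mult.assoc)
    qed
  qed (use that K in \<open>auto simp: G_def\<close>)
  have graph: "(lin y x, lin (\<tau> y) x) \<in> G" if "x \<in> X" for x y
    using that by (auto simp: G_def lin_mem \<tau>X lin_rin \<tau>B rin_mem)
  then have G_dense: "{lin y x | y x. x \<in> X} \<subseteq> fst ` G"
    by force
  obtain \<psi> where \<psi>: "bounded_linear \<psi>" "\<And>c. norm (\<psi> c) \<le> K * norm c"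
    "\<And>c a. (c, a) \<in> G \<longleftrightarrow> a = \<psi> c"
    using closed_relation_is_map[OF G_closed G_subspace G_bound lin_dense G_dense] by blast
  have "(c, \<psi> c) \<in> G" for c using \<psi>(3) by simp
  then have \<psi>A: "\<psi> c \<in> A" and \<psi>_lact: "x \<in> X \<Longrightarrow> lact (\<psi> c) x = \<tau> (lact c x)" for x c
    by (auto simp: G_def)
  have lin_\<tau>: "x \<in> X \<Longrightarrow> lin (\<tau> y) x = \<psi> (lin y x)" for x y
    using \<psi>(3) graph by simp
  have "\<psi> (a * c) = a * \<psi> c" "\<psi> (c * a) = \<psi> c * a" if a: "a \<in> A" for a c
  proof -
    show "\<psi> (a * c) = a * \<psi> c"
      by (rule lact_cancel) (simp_all add: \<psi>A mult_A a \<psi>_lact lact_mult \<tau>A)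
    show "\<psi> (c * a) = \<psi> c * a"
      by (rule lact_cancel) (simp_all add: \<psi>A mult_A a \<psi>_lact lact_mult lact_mem)
  qed
  then have "bimodule_map_bound A K \<psi>"
    using \<psi>A \<psi>(1,2) K by (auto simp: bimodule_map_bound_def)
  moreover have "linked \<phi> \<tau> \<psi>"
    by (simp add: linked_def \<phi>B \<tau>X \<psi>A rin_\<tau> lin_\<tau> \<tau>_ract \<psi>_lact)
  ultimately show thesis using that by blast
qed

lemma linked_unique:
  assumes "linked \<phi> \<tau> \<psi>" "linked \<phi> \<tau>' \<psi>'"
  shows "\<tau> = \<tau>'" "\<psi> = \<psi>'"
proof -
  have "\<tau> y = \<tau>' y" for y
    using assms by (intro rin_cancel) (auto simp: linked_def)
  then show "\<tau> = \<tau>'" ..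
  then have "\<psi> c = \<psi>' c" for c
    using assms by (intro lact_cancel) (auto simp: linked_def)
  then show "\<psi> = \<psi>'" ..
qed

lemma linked_dual:
  "bimodule_inclusion.linked B A X (\<lambda>d y. ract y (star d)) (\<lambda>y c. lact (star c) y) rin lin
      (star_conj \<psi>) \<tau> (star_conj \<phi>) \<longleftrightarrow> linked \<phi> \<tau> \<psi>"
proof -
  have mem: "(\<forall>d. star (\<phi> (star d)) \<in> B) \<longleftrightarrow> (\<forall>d. \<phi> d \<in> B)"
    "(\<forall>c. star (\<psi> (star c)) \<in> A) \<longleftrightarrow> (\<forall>c. \<psi> c \<in> A)"
    by (metis star_B star_star) (metis star_A star_star)
  have star_eq: "a = star a' \<longleftrightarrow> star a = a'" for a a' :: "'e::cstar_algebra"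
    by (metis star_star)
  have stars: "(\<forall>d. \<tau> (ract x (star d)) = ract x (\<phi> (star d))) \<longleftrightarrow>
      (\<forall>d. \<tau> (ract x d) = ract x (\<phi> d))"
    "(\<forall>c. \<tau> (lact (star c) x) = lact (\<psi> (star c)) x) \<longleftrightarrow>
      (\<forall>c. \<tau> (lact c x) = lact (\<psi> c) x)" for x
    by (metis star_star)+
  show ?thesis
    unfolding bimodule_inclusion.linked_def[OF dual] linked_def star_conj_def
    by (simp add: mem star_eq star_lin star_rin star_star stars) blast
qed

lemma linked_exists_dual:
  assumes "bimodule_map_bound A K \<psi>"
  obtains \<phi> \<tau> where "linked \<phi> \<tau> \<psi>" "bimodule_map_bound B K \<phi>"
proof -
  obtain \<tau> \<phi> where "bimodule_inclusion.linked B A X (\<lambda>d y. ract y (star d))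
      (\<lambda>y c. lact (star c) y) rin lin (star_conj \<psi>) \<tau> \<phi>" and \<phi>: "bimodule_map_bound B K \<phi>"
    using bimodule_inclusion.linked_exists[OF dual bimodule_map_bound_star_conj[OF assms star_A]]
    by blast
  then have "linked (star_conj \<phi>) \<tau> \<psi>"
    using linked_dual[of \<psi> \<tau> "star_conj \<phi>"] by (simp add: star_conj_star_conj)
  then show thesis
    using that bimodule_map_bound_star_conj[OF \<phi> star_B] by blast
qed

lemma linked_unique_dual:
  assumes "linked \<phi> \<tau> \<psi>" "linked \<phi>' \<tau>' \<psi>"
  shows "\<phi> = \<phi>'"
proof -
  have "star_conj \<phi> = star_conj \<phi>'"
    using assms[folded linked_dual] by (rule bimodule_inclusion.linked_unique(2)[OF dual])
  then show ?thesis by (metis star_conj_star_conj)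
qed

end

lemma bimodule_inclusion_if_morita:
  assumes A: "cstar_subalgebra A" and B: "cstar_subalgebra B"
    and morita: "inclusion_morita_equivalence A B X lact ract lin rin"
  shows "bimodule_inclusion A B X lact ract lin rin"
proof -
  interpret equivalence_bimodule lact ract lin rin
    using morita by (simp add: inclusion_morita_equivalence_def)
  have csub: "csubspace A" "csubspace B" "csubspace X"
    using assms by (simp_all add: cstar_subalgebra_def inclusion_morita_equivalence_def)
  have X_scaleC: "k *\<^sub>C x \<in> X" if "x \<in> X" for k x
    using csub(3) that by (rule complex_vector.subspace_scale)
  have real: "subspace S" if "csubspace S" for S :: "'z::complex_normed_vector set"
    using that by (auto simp: complex_vector.subspace_def subspace_def scaleR_scaleC)
  have "cspan {lin x z | x z. x \<in> X \<and> z \<in> X} = span {lin x z | x z. x \<in> X \<and> z \<in> X}"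
    by (rule cspan_eq_span) (use X_scaleC in \<open>blast intro: lin_scaleC_left[symmetric]\<close>)
  moreover have "cspan {rin x z | x z. x \<in> X \<and> z \<in> X} = span {rin x z | x z. x \<in> X \<and> z \<in> X}"
    by (rule cspan_eq_span) (use X_scaleC in \<open>blast intro: rin_scaleC_right[symmetric]\<close>)
  moreover have "cspan {lin y x | y x. x \<in> X} = span {lin y x | y x. x \<in> X}"
    by (rule cspan_eq_span) (blast intro: lin_scaleC_left[symmetric])
  moreover have "cspan {rin y x | y x. x \<in> X} = span {rin y x | y x. x \<in> X}"
    by (rule cspan_eq_span) (use X_scaleC in \<open>blast intro: rin_scaleC_right[symmetric]\<close>)
  ultimately have spans: "A = closure (span {lin x z | x z. x \<in> X \<and> z \<in> X})"
    "B = closure (span {rin x z | x z. x \<in> X \<and> z \<in> X})"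
    "closure (span {lin y x | y x. x \<in> X}) = UNIV"
    "closure (span {rin y x | y x. x \<in> X}) = UNIV"
    using morita by (simp_all add: inclusion_morita_equivalence_def)
  have AB: "a \<in> A \<Longrightarrow> a' \<in> A \<Longrightarrow> a * a' \<in> A" "a \<in> A \<Longrightarrow> star a \<in> A" "closed A"
    "b \<in> B \<Longrightarrow> b' \<in> B \<Longrightarrow> b * b' \<in> B" "b \<in> B \<Longrightarrow> star b \<in> B" "closed B" for a a' b b'
    using A B by (simp_all add: cstar_subalgebra_def)
  have mems: "closed X" "a \<in> A \<Longrightarrow> x \<in> X \<Longrightarrow> lact a x \<in> X" "x \<in> X \<Longrightarrow> b \<in> B \<Longrightarrow> ract x b \<in> X"
    "x \<in> X \<Longrightarrow> z \<in> X \<Longrightarrow> lin x z \<in> A" "x \<in> X \<Longrightarrow> z \<in> X \<Longrightarrow> rin x z \<in> B" for a b x z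
    using morita by (simp_all add: inclusion_morita_equivalence_def)
  show ?thesis
    by (rule bimodule_inclusion.intro; (rule bounded_bilinear_lact bounded_bilinear_ract
          bounded_bilinear_lin bounded_bilinear_rin norm_lact_le norm_ract_le norm_lin_le
          norm_rin_le norm_lin_self norm_rin_self lact_mult ract_mult lact_ract star_lin star_rin
          lin_lact_left rin_ract_right lin_ract rin_lact lin_rin real[OF csub(1)] real[OF csub(2)]
          real[OF csub(3)] AB(3) AB(6) mems(1) equalityD1[OF spans(1)] equalityD1[OF spans(2)]
          spans(3,4) lact_dense ract_dense | erule (1) AB(1,4) mems(2-5) | erule AB(2,5)))
qed

text \<open>
  Complex linearity is automatic for bimodule maps: \<open>\<psi> (k (a c)) = (k a) \<psi> c\<close> because \<open>k a\<close> lies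
  in \<open>A\<close>, and the products \<open>a c\<close> span a dense subspace.
\<close>

lemma bimodule_map_clinear:
  assumes \<psi>: "bimodule_map_bound A K \<psi>" and A: "csubspace A"
    and dense: "closed_cspan {a * c | a c. a \<in> A} = UNIV"
  shows "clinear \<psi>"
proof -
  interpret \<psi>: bounded_linear \<psi>
    using \<psi> by (simp add: bimodule_map_bound_def)
  let ?P = "{a * c | a c. a \<in> A}"
  have kA: "k *\<^sub>C a \<in> A" if "a \<in> A" for k a
    using A that by (rule complex_vector.subspace_scale)
  have "cspan ?P = span ?P"
    by (rule cspan_eq_span) (use kA in \<open>blast intro: mult_scaleC_left[symmetric]\<close>)
  with dense have "closure (span ?P) = UNIV" by simp
  have "{c. \<psi> (k *\<^sub>C c) - k *\<^sub>C \<psi> c \<in> {0}} = UNIV" for k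
  proof (rule closed_subspace_UNIV)
    have "bounded_linear (\<lambda>c. \<psi> (k *\<^sub>C c) - k *\<^sub>C \<psi> c)"
      by (intro bounded_linear_sub bounded_linear_compose[OF \<psi>.bounded_linear]
          bounded_linear_compose[OF bounded_linear_scaleC] bounded_linear_scaleC
          \<psi>.bounded_linear)
    from closed_subspace_vimage[OF this closed_singleton subspace_single_0]
    show "closed {c. \<psi> (k *\<^sub>C c) - k *\<^sub>C \<psi> c \<in> {0}}"
      "subspace {c. \<psi> (k *\<^sub>C c) - k *\<^sub>C \<psi> c \<in> {0}}" .
    have "\<psi> (k *\<^sub>C (a * c)) = k *\<^sub>C \<psi> (a * c)" if "a \<in> A" for a c
    proof -
      have "\<psi> ((k *\<^sub>C a) * c) = (k *\<^sub>C a) * \<psi> c" "\<psi> (a * c) = a * \<psi> c"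
        using \<psi> kA[OF that] that by (simp_all add: bimodule_map_bound_def)
      then show ?thesis by (simp add: mult_scaleC_left)
    qed
    then show "?P \<subseteq> {c. \<psi> (k *\<^sub>C c) - k *\<^sub>C \<psi> c \<in> {0}}" by auto
  qed fact
  then have "\<psi> (k *\<^sub>C c) = k *\<^sub>C \<psi> c" for k c
    by (metis (mono_tags, lifting) UNIV_I eq_iff_diff_eq_0 mem_Collect_eq singletonD)
  then show ?thesis
    by (unfold_locales) (simp_all add: \<psi>.add)
qed

lemma bimodule_map_bound_onorm:
  "\<psi> \<in> bounded_bimodule_maps A \<Longrightarrow> bimodule_map_bound A (onorm \<psi>) \<psi>"
  by (auto simp: bounded_bimodule_maps_def bimodule_map_bound_def onorm onorm_pos_le)

lemma bounded_bimodule_maps_iff: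
  assumes "csubspace A" "closed_cspan {a * c | a c. a \<in> A} = UNIV"
  shows "\<psi> \<in> bounded_bimodule_maps A \<longleftrightarrow> (\<exists>K. bimodule_map_bound A K \<psi>)"
proof
  assume "\<psi> \<in> bounded_bimodule_maps A"
  then show "\<exists>K. bimodule_map_bound A K \<psi>"
    using bimodule_map_bound_onorm by blast
next
  assume "\<exists>K. bimodule_map_bound A K \<psi>"
  then show "\<psi> \<in> bounded_bimodule_maps A"
    using bimodule_map_clinear[OF _ assms]
    by (auto simp: bounded_bimodule_maps_def bimodule_map_bound_def)
qed

lemma bounded_bimodule_maps_add:
  assumes A: "csubspace A" and "\<psi> \<in> bounded_bimodule_maps A" "\<psi>' \<in> bounded_bimodule_maps A"
  shows "(\<lambda>c. \<psi> c + \<psi>' c) \<in> bounded_bimodule_maps A"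
proof -
  have "clinear (\<lambda>c. \<psi> c + \<psi>' c)"
    using assms by (auto simp: bounded_bimodule_maps_def Vector_Spaces.linear_iff scaleC_add_right)
  then show ?thesis
    using assms complex_vector.subspace_add[OF A]
    by (auto simp: bounded_bimodule_maps_def bounded_linear_add algebra_simps image_subset_iff)
qed

lemma bounded_bimodule_maps_scaleC:
  assumes A: "csubspace A" and "\<psi> \<in> bounded_bimodule_maps A"
  shows "(\<lambda>c. k *\<^sub>C \<psi> c) \<in> bounded_bimodule_maps A"
proof -
  have "clinear (\<lambda>c. k *\<^sub>C \<psi> c)"
    using assms
    by (auto simp: bounded_bimodule_maps_def Vector_Spaces.linear_iff scaleC_add_right scaleC_scaleC mult.commute)
  then show ?thesis
    using assms complex_vector.subspace_scale[OF A]
    by (auto simp: bounded_bimodule_maps_def bounded_linear_compose[OF bounded_linear_scaleC]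
        mult_scaleC_left mult_scaleC_right image_subset_iff)
qed

lemma morita_map_eq:
  assumes bimod: "equivalence_bimodule lact ract lin rin"
    and incl: "bimodule_inclusion A B X lact ract lin rin"
    and X: "csubspace X" and linked: "bimodule_inclusion.linked A B X lact ract lin rin \<phi> \<tau> \<psi>"
    and \<phi>: "clinear \<phi>" and \<psi>: "clinear \<psi>"
  shows "morita_map A X lact rin \<phi> = \<psi>"
proof -
  interpret equivalence_bimodule lact ract lin rin by fact
  interpret incl: bimodule_inclusion A B X lact ract lin rin by fact
  interpret \<phi>: Vector_Spaces.linear scaleC scaleC \<phi> by fact
  note l = linked[unfolded incl.linked_def]
  have "clinear \<tau>"
  proof unfold_locales
    show "\<tau> (y + y') = \<tau> y + \<tau> y'" for y y'
      using l by (intro incl.rin_cancel)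
        (auto simp: rin_add_right \<phi>.add intro: complex_vector.subspace_add[OF X])
    show "\<tau> (k *\<^sub>C y) = k *\<^sub>C \<tau> y" for k y
      using l by (intro incl.rin_cancel)
        (auto simp: rin_scaleC_right \<phi>.scale intro: complex_vector.subspace_scale[OF X])
  qed
  have tau: "tau_map X rin \<phi> = \<tau>"
    unfolding tau_map_def
  proof (rule the_equality)
    show "clinear \<tau> \<and> range \<tau> \<subseteq> X \<and> (\<forall>x\<in>X. \<forall>y. rin x (\<tau> y) = \<phi> (rin x y))"
      using l \<open>clinear \<tau>\<close> by auto
    fix \<sigma> assume \<sigma>: "clinear \<sigma> \<and> range \<sigma> \<subseteq> X \<and> (\<forall>x\<in>X. \<forall>y. rin x (\<sigma> y) = \<phi> (rin x y))"
    have "\<sigma> y = \<tau> y" for y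
      using l \<sigma> by (intro incl.rin_cancel) auto
    then show "\<sigma> = \<tau>" ..
  qed
  show ?thesis
    unfolding morita_map_def tau
  proof (rule the_equality)
    show "clinear \<psi> \<and> range \<psi> \<subseteq> A \<and> (\<forall>c. \<forall>x\<in>X. lact (\<psi> c) x = \<tau> (lact c x))"
      using l \<psi> by auto
    fix \<sigma> assume \<sigma>: "clinear \<sigma> \<and> range \<sigma> \<subseteq> A \<and> (\<forall>c. \<forall>x\<in>X. lact (\<sigma> c) x = \<tau> (lact c x))"
    have "\<sigma> c = \<psi> c" for c
      using l \<sigma> by (intro incl.lact_cancel) auto
    then show "\<sigma> = \<psi>" ..
  qed
qed

theorem mainTheorem2:
  fixes A :: "'c::cstar_algebra set"
    and B :: "'d::cstar_algebra set"
    and X :: "'y::complex_banach set"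
    and lact :: "'c \<Rightarrow> 'y \<Rightarrow> 'y"
    and ract :: "'y \<Rightarrow> 'd \<Rightarrow> 'y"
    and lin :: "'y \<Rightarrow> 'y \<Rightarrow> 'c"
    and rin :: "'y \<Rightarrow> 'y \<Rightarrow> 'd"
  assumes "cstar_subalgebra A"
    and "cstar_subalgebra B"
    and "closed_cspan {a * c | a c. a \<in> A} = UNIV"
    and "closed_cspan {b * d | b d. b \<in> B} = UNIV"
    and "inclusion_morita_equivalence A B X lact ract lin rin"
  shows "bij_betw (morita_map A X lact rin) (bounded_bimodule_maps B) (bounded_bimodule_maps A) \<and>
    (\<forall>\<phi>\<in>bounded_bimodule_maps B. \<forall>\<phi>'\<in>bounded_bimodule_maps B.
      morita_map A X lact rin (\<lambda>d. \<phi> d + \<phi>' d) =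
        (\<lambda>c. morita_map A X lact rin \<phi> c + morita_map A X lact rin \<phi>' c)) \<and>
    (\<forall>\<phi>\<in>bounded_bimodule_maps B. \<forall>k.
      morita_map A X lact rin (\<lambda>d. k *\<^sub>C \<phi> d) = (\<lambda>c. k *\<^sub>C morita_map A X lact rin \<phi> c)) \<and>
    (\<forall>\<phi>\<in>bounded_bimodule_maps B. onorm (morita_map A X lact rin \<phi>) = onorm \<phi>)"
proof -
  let ?f = "morita_map A X lact rin"
  note morita = assms(5)
  interpret equivalence_bimodule lact ract lin rin
    using morita by (simp add: inclusion_morita_equivalence_def)
  interpret incl: bimodule_inclusion A B X lact ract lin rin
    using assms by (intro bimodule_inclusion_if_morita)
  have csub: "csubspace A" "csubspace B" "csubspace X"
    using assms by (simp_all add: cstar_subalgebra_def inclusion_morita_equivalence_def)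
  note iffA = bounded_bimodule_maps_iff[OF csub(1) assms(3)]
  note iffB = bounded_bimodule_maps_iff[OF csub(2) assms(4)]
  have f_eq: "?f \<phi> = \<psi>"
    if "incl.linked \<phi> \<tau> \<psi>" "\<phi> \<in> bounded_bimodule_maps B" "\<psi> \<in> bounded_bimodule_maps A"
    for \<phi> \<tau> \<psi>
    using that morita_map_eq[OF equivalence_bimodule_axioms incl.bimodule_inclusion_axioms csub(3)]
    by (auto simp: bounded_bimodule_maps_def)
  have forward: "\<exists>\<tau>. incl.linked \<phi> \<tau> (?f \<phi>) \<and> bimodule_map_bound A K (?f \<phi>)"
    if \<phi>: "bimodule_map_bound B K \<phi>" for K \<phi>
  proof -
    obtain \<tau> \<psi> where "incl.linked \<phi> \<tau> \<psi>" "bimodule_map_bound A K \<psi>"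
      using incl.linked_exists[OF \<phi>] .
    moreover from this \<phi> have "?f \<phi> = \<psi>"
      by (intro f_eq) (auto simp: iffA iffB)
    ultimately show ?thesis by auto
  qed
  have f_linked: "\<exists>\<tau>. incl.linked \<phi> \<tau> (?f \<phi>)" and f_mem: "?f \<phi> \<in> bounded_bimodule_maps A"
    if "\<phi> \<in> bounded_bimodule_maps B" for \<phi>
    using forward that by (auto simp: iffA iffB)
  have "bij_betw ?f (bounded_bimodule_maps B) (bounded_bimodule_maps A)"
    unfolding bij_betw_def
  proof
    show "inj_on ?f (bounded_bimodule_maps B)"
    proof (rule inj_onI)
      fix \<phi> \<phi>' assume "\<phi> \<in> bounded_bimodule_maps B" "\<phi>' \<in> bounded_bimodule_maps B"
        and eq: "?f \<phi> = ?f \<phi>'"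
      then obtain \<tau> \<tau>' where "incl.linked \<phi> \<tau> (?f \<phi>)" "incl.linked \<phi>' \<tau>' (?f \<phi>')"
        using f_linked by blast
      then show "\<phi> = \<phi>'"
        using incl.linked_unique_dual eq by simp
    qed
    show "?f ` bounded_bimodule_maps B = bounded_bimodule_maps A"
    proof
      show "?f ` bounded_bimodule_maps B \<subseteq> bounded_bimodule_maps A"
        using f_mem by blast
      show "bounded_bimodule_maps A \<subseteq> ?f ` bounded_bimodule_maps B"
      proof
        fix \<psi> assume \<psi>: "\<psi> \<in> bounded_bimodule_maps A"
        obtain \<phi> \<tau> where l: "incl.linked \<phi> \<tau> \<psi>" "bimodule_map_bound B (onorm \<psi>) \<phi>"
          using incl.linked_exists_dual[OF bimodule_map_bound_onorm[OF \<psi>]] .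
        then have "\<phi> \<in> bounded_bimodule_maps B" by (auto simp: iffB)
        with f_eq[OF l(1) this \<psi>] show "\<psi> \<in> ?f ` bounded_bimodule_maps B" by auto
      qed
    qed
  qed
  moreover have "?f (\<lambda>d. \<phi> d + \<phi>' d) = (\<lambda>c. ?f \<phi> c + ?f \<phi>' c)"
    if \<phi>: "\<phi> \<in> bounded_bimodule_maps B" "\<phi>' \<in> bounded_bimodule_maps B" for \<phi> \<phi>'
  proof -
    obtain \<tau> \<tau>' where l: "incl.linked \<phi> \<tau> (?f \<phi>)" "incl.linked \<phi>' \<tau>' (?f \<phi>')"
      using f_linked \<phi> by blast
    show ?thesis
    proof (rule f_eq)
      show "incl.linked (\<lambda>d. \<phi> d + \<phi>' d) (\<lambda>y. \<tau> y + \<tau>' y) (\<lambda>c. ?f \<phi> c + ?f \<phi>' c)"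
        using l complex_vector.subspace_add[OF csub(1)] complex_vector.subspace_add[OF csub(2)]
          complex_vector.subspace_add[OF csub(3)]
        by (simp add: incl.linked_def rin_add_right lin_add_left ract_add_right lact_add_left)
    qed (use \<phi> f_mem[OF \<phi>(1)] f_mem[OF \<phi>(2)] bounded_bimodule_maps_add csub in blast)+
  qed
  moreover have "?f (\<lambda>d. k *\<^sub>C \<phi> d) = (\<lambda>c. k *\<^sub>C ?f \<phi> c)"
    if \<phi>: "\<phi> \<in> bounded_bimodule_maps B" for \<phi> k
  proof -
    obtain \<tau> where l: "incl.linked \<phi> \<tau> (?f \<phi>)"
      using f_linked \<phi> by blast
    show ?thesis
    proof (rule f_eq)
      show "incl.linked (\<lambda>d. k *\<^sub>C \<phi> d) (\<lambda>y. k *\<^sub>C \<tau> y) (\<lambda>c. k *\<^sub>C ?f \<phi> c)"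
        using l complex_vector.subspace_scale[OF csub(1)] complex_vector.subspace_scale[OF csub(2)]
          complex_vector.subspace_scale[OF csub(3)]
        by (simp add: incl.linked_def rin_scaleC_right lin_scaleC_left ract_scaleC_right
            lact_scaleC_left)
    qed (use \<phi> f_mem[OF \<phi>] bounded_bimodule_maps_scaleC csub in blast)+
  qed
  moreover have "onorm (?f \<phi>) = onorm \<phi>" if \<phi>: "\<phi> \<in> bounded_bimodule_maps B" for \<phi>
  proof (rule antisym)
    have "bimodule_map_bound A (onorm \<phi>) (?f \<phi>)"
      using forward[OF bimodule_map_bound_onorm[OF \<phi>]] by blast
    then show "onorm (?f \<phi>) \<le> onorm \<phi>"
      by (auto simp: bimodule_map_bound_def intro: onorm_bound)
    obtain \<tau> where l: "incl.linked \<phi> \<tau> (?f \<phi>)"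
      using f_linked \<phi> by blast
    obtain \<phi>' \<tau>' where l': "incl.linked \<phi>' \<tau>' (?f \<phi>)" "bimodule_map_bound B (onorm (?f \<phi>)) \<phi>'"
      using incl.linked_exists_dual[OF bimodule_map_bound_onorm[OF f_mem[OF \<phi>]]] .
    have "\<phi>' = \<phi>" using incl.linked_unique_dual[OF l'(1) l] .
    with l'(2) show "onorm \<phi> \<le> onorm (?f \<phi>)"
      by (auto simp: bimodule_map_bound_def intro: onorm_bound)
  qed
  ultimately show ?thesis by blast
qed

end
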